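(* In the setting described in the context, let $(\varepsilon_i')_{i\ge1}$ be an independent copy of $(\varepsilon_i)_{i\ge1}$ and assume that there exist positive constants $M_k$ such that $$\big\|d\big(F_k((X_{k-i})_{i\ge1};\varepsilon_k),F_k((X_{k-i})_{i\ge1};\varepsilon_k')\big)\big\|_\infty\le M_k,\qquad k\in[1,n].$$ Let $$M^2(n)=\sum_{k=1}^n\big(a_{n-k}(n-k)M_k\big)^2,\qquad D(n)=\sum_{k=1}^na_{n-k}(n-k)M_k.$$ Then, for either choice of sign and every $t\ge0$, $$\mathbb E[e^{\pm tS_n}]\le\exp\Big(\frac{D^2(n)}{M^2(n)}\,\ell\Big(\frac{M^2(n)\,t}{D(n)}\Big)\Big),$$ and, for every $x\in[0,D(n)]$, $$\mathbb P(\pm S_n>x)\le\exp\Big(-\frac{D^2(n)}{M^2(n)}\,\ell^*\Big(\frac{x}{D(n)}\Big)\Big).$$ Consequently, for every $x\in[0,D(n)]$, $$\mathbb P(\pm S_n>x)\le\Big(\frac{D(n)-x}{D(n)}\Big)^{\frac{2D(n)x-x^2}{M^2(n)}}.$$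
   Context: Let $(\mathcal X,d)$ and $(\mathcal Y,\delta)$ be complete separable metric spaces. Let $(\varepsilon_i)_{i\ge1}$ be independent (not necessarily identically distributed) $\mathcal Y$-valued random variables. Let $(X_i)_{i\le0}$ be a deterministic sequence in $\mathcal X$. For each $m\ge1$ let $F_m:\mathcal X^{\mathbb N}\times\mathcal Y\to\mathcal X$ be measurable, and define recursively $X_m=F_m((X_{m-i})_{i\ge1};\varepsilon_m)$ for $m\ge1$. Assume there are nonnegative numbers $a_i$, $i\ge1$, with $\sum_{i\ge1}a_i<1$, such that for all $m\ge1$ and all sequences $(x_{m-i})_{i\ge1},(x'_{m-i})_{i\ge1}$ in $\mathcal X$, $$\mathbb E\big[d\big(F_m((x_{m-i})_{i\ge1};\varepsilon_m),F_m((x'_{m-i})_{i\ge1};\varepsilon_m)\big)\big]\le\sum_{i=1}^\infty a_i\,d(x_{m-i},x'_{m-i}).$$ Fix $n\ge1$ and let $f:\mathcal X^n\to\mathbb R$ satisfy $|f(x_1,\ldots,x_n)-f(x'_1,\ldots,x'_n)|\le\sum_{i=1}^n d(x_i,x'_i)$. Put $S_n=f(X_1,\ldots,X_n)-\mathbb E[f(X_1,\ldots,X_n)]$. The numbers $a_k(k)$, $k\ge0$, are defined recursively by $a_0(0)=1$ and $a_k(k)=1+a_k+\sum_{l=1}^{k-1}a_l(l)\,a_{k-l}$ for $k\ge1$ (so $a_1(1)=1+a_1$). $\|\cdot\|_\infty$ is the essential supremum norm. For $t>0$, $\ell(t)=(t-\ln t-1)+t(e^t-1)^{-1}+\ln(1-e^{-t})$,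 extended by its limit $\ell(0)=0$; and $\ell^*(x)=\sup_{t>0}(xt-\ell(t))\in[0,+\infty]$ for $x\ge0$, with $\exp(-\infty)=0$. *)

theory Defs
  imports "HOL-Probability.Probability"
begin

text \<open>The sequence \<open>(x\<^sub>m\<^sub>-\<^sub>i)\<^sub>i\<^sub>\<ge>\<^sub>1\<close>, stored with its indices shifted by one: entry \<open>j\<close> is
  \<open>x\<^sub>m\<^sub>-\<^sub>(\<^sub>j\<^sub>+\<^sub>1\<^sub>)\<close>. Elements of \<open>\<X>\<^sup>\<nat>\<close> are thus total functions on \<open>nat\<close>.\<close>

definition preceding :: "(int \<Rightarrow> 'x) \<Rightarrow> nat \<Rightarrow> nat \<Rightarrow> 'x" where
  "preceding x m = (\<lambda>j. x (int m - int (Suc j)))"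

text \<open>\<open>a_diag a k\<close> is the number written \<open>a\<^sub>k(k)\<close>. The value \<open>a 0\<close> is never used.\<close>

fun a_diag :: "(nat \<Rightarrow> real) \<Rightarrow> nat \<Rightarrow> real" where
  "a_diag a 0 = 1"
| "a_diag a (Suc k) = 1 + a (Suc k) + (\<Sum>l=1..k. a_diag a l * a (Suc k - l))"

text \<open>The family \<open>X'\<close> is an independent copy of \<open>X\<close>: as random elements of the product space,
  the two families are independent and have the same law.\<close>

definition (in prob_space) indep_copy ::
  "'i set \<Rightarrow> 'b measure \<Rightarrow> ('i \<Rightarrow> 'a \<Rightarrow> 'b) \<Rightarrow> ('i \<Rightarrow> 'a \<Rightarrow> 'b) \<Rightarrow> bool" where
  "indep_copy I N X X' \<longleftrightarrow>
     indep_var (\<Pi>\<^sub>M i\<in>I. N) (\<lambda>\<omega>. \<lambda>i\<in>I. X i \<omega>) (\<Pi>\<^sub>M i\<in>I. N) (\<lambda>\<omega>. \<lambda>i\<in>I. X' i \<omega>) \<and>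
     distr M (\<Pi>\<^sub>M i\<in>I. N) (\<lambda>\<omega>. \<lambda>i\<in>I. X' i \<omega>) = distr M (\<Pi>\<^sub>M i\<in>I. N) (\<lambda>\<omega>. \<lambda>i\<in>I. X i \<omega>)"

text \<open>Only arguments \<open>t \<ge> 0\<close> are meaningful; the value at \<open>0\<close> is the right limit of the formula.\<close>

definition ell :: "real \<Rightarrow> real" where
  "ell t = (if t = 0 then 0
            else (t - ln t - 1) + t * inverse (exp t - 1) + ln (1 - exp (- t)))"

definition ell_star :: "real \<Rightarrow> ereal" where
  "ell_star x = (SUP t\<in>{0<..}. ereal (x * t - ell t))"

definition exp_ereal :: "ereal \<Rightarrow> ereal" where
  "exp_ereal z = (if z = \<infinity> then \<infinity> else if z = - \<infinity> then 0 else ereal (exp (real_of_ereal z)))"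

end

theory Submission
  imports Defs
begin

text \<open>
  Along the process, the conditional expectations of \<open>f(X\<^sub>1,\<dots>,X\<^sub>n)\<close> given the first \<open>k\<close> steps form a
  martingale. By backward induction on \<open>k\<close>, the contraction assumption makes the \<open>k\<close>-th one
  Lipschitz in its last coordinate with constant \<open>a\<^sub>n\<^sub>-\<^sub>k(n-k)\<close>, so that its increment, given the past,
  oscillates by at most \<open>T\<^sub>k = a\<^sub>n\<^sub>-\<^sub>k(n-k) M\<^sub>k\<close>. Convexity of \<open>exp\<close> compares this increment with a centered
  two-point variable, and \<open>\<ell>(t)\<close> is the supremum of \<open>ln (1 - p + p e\<^sup>t) - p t\<close> over \<open>p\<close>; hence
  \<open>ln E e\<^sup>t\<^sup>S \<le> \<Sum> \<ell>(T\<^sub>k t)\<close>. Rio's observation that \<open>\<ell>(t)/t\<close> is concave turns this sum into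
  \<open>D\<^sup>2/M\<^sup>2 \<ell>(M\<^sup>2 t/D)\<close>. Concavity follows from \<open>\<ell>(2z) = ln (sinh z / z) + z L(z)\<close>, where
  \<open>L(z) = coth z - 1/z\<close> is the derivative of \<open>ln (sinh z / z)\<close>, since \<open>L\<close> is concave by
  Lazarevic's inequality \<open>z\<^sup>3 cosh z \<le> sinh\<^sup>3 z\<close>. The explicit tail bound amounts to
  \<open>\<ell>\<^sup>*(y) \<ge> (y\<^sup>2 - 2y) ln (1 - y)\<close>, which the choice \<open>t = 4y\<close> yields for \<open>y \<le> 1/2\<close> and
  \<open>t = 1/(1 - y)\<close> for \<open>y \<ge> 1/2\<close>.
\<close>

section \<open>Concavity of \<open>\<ell>(t)/t\<close>\<close>

text \<open>\<open>g\<close> is nondecreasing to the right of 0, so its right limit at 0 bounds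
  \<open>g b\<close> from below. A limit instead of a value at 0 suits functions such as coth z -
  1/z, which have a removable singularity there.\<close>

lemma nonneg_if_deriv_nonneg_limit_0:
  fixes g g' :: "real \<Rightarrow> real"
  assumes "b > 0"
    and deriv: "\<And>x. 0 < x \<Longrightarrow> x \<le> b \<Longrightarrow> (g has_real_derivative g' x) (at x)"
    and nonneg: "\<And>x. 0 < x \<Longrightarrow> x \<le> b \<Longrightarrow> g' x \<ge> 0"
    and lim: "(g \<longlongrightarrow> 0) (at_right 0)"
  shows "g b \<ge> 0"
proof (rule tendsto_upperbound[OF lim])
  have "g x \<le> g b" if "x \<in> {0<..<b}" for x
    using that by (intro DERIV_nonneg_imp_nondecreasing[of x b g]) (auto intro!: exI deriv nonneg)
  then show "eventually (\<lambda>x. g x \<le> g b) (at_right 0)"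
    using eventually_at_right_real[OF \<open>b > 0\<close>] by (rule eventually_mono[rotated])
qed simp

definition langevin :: "real \<Rightarrow> real" where
  "langevin z = cosh z / sinh z - 1 / z"

text \<open>The logarithm of the moment generating function of the uniform distribution on
  [-1, 1].\<close>

definition ln_sinhc :: "real \<Rightarrow> real" where
  "ln_sinhc z = ln (sinh z / z)"

lemma ln_sinhc_deriv [derivative_intros]:
  assumes "z > 0"
  shows "(ln_sinhc has_real_derivative langevin z) (at z)"
  unfolding ln_sinhc_def[abs_def] langevin_def using assms
  by (auto intro!: derivative_eq_intros simp: field_simps power2_eq_square)

lemma ln_sinhc_tendsto_0: "(ln_sinhc \<longlongrightarrow> 0) (at_right 0)"
  unfolding ln_sinhc_def[abs_def] sinh_field_def by real_asymp

text \<open>Writing sinh z = e^z (1 - e^(-2z)) / 2 and coth z = 1 + 2 / (e^(2z) - 1) reproduces the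
  summands of \<open>ell\<close> at 2z.\<close>

lemma ell_eq_langevin:
  assumes "z > 0"
  shows "ell (2 * z) = ln_sinhc z + z * langevin z"
proof -
  have e: "exp (2 * z) = exp z * exp z" "exp (-(2 * z)) = inverse (exp z) * inverse (exp z)"
    by (simp_all flip: exp_add exp_minus)
  have gt: "exp z > 1" using assms by simp
  have gt2: "exp z * exp z > 1" using gt by (simp add: less_1_mult)
  have pos: "1 - exp (-(2 * z)) > 0" using assms by simp
  have "sinh z / z = exp z * (1 - exp (-(2 * z))) / (2 * z)"
    unfolding e sinh_field_def using assms by (simp add: field_simps exp_minus)
  then have "ln_sinhc z = ln (exp z * (1 - exp (-(2 * z))) / (2 * z))"
    by (simp add: ln_sinhc_def)
  also have "\<dots> = z + ln (1 - exp (-(2 * z))) - ln (2 * z)"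
    using assms pos by (simp add: ln_div ln_mult)
  finally have 1: "ln_sinhc z = z + ln (1 - exp (-(2 * z))) - ln (2 * z)" .
  have "cosh z / sinh z = 1 + 2 * inverse (exp (2 * z) - 1)"
    unfolding e sinh_field_def cosh_field_def using gt gt2 by (simp add: field_simps exp_minus)
  then have "z * langevin z = z + 2 * z * inverse (exp (2 * z) - 1) - 1"
    using assms by (simp add: langevin_def field_simps)
  then show ?thesis using 1 assms by (simp add: ell_def)
qed

text \<open>With u the cube root of cosh, the claim reads z <= sinh z / u. Since sinh^2 = u^6 - 1,
  the difference has derivative (2 u^6 - 3 u^4 + 1) / (3 u^4), and the numerator factors as (u^2 -
  1)^2 (2 u^2 + 1).\<close>

lemma lazarevic:
  fixes z :: real
  assumes "z > 0"
  shows "z ^ 3 * cosh z \<le> sinh z ^ 3"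
proof -
  define u where "u = (\<lambda>z::real. exp (ln (cosh z) / 3))"
  have u_pos: "u x > 0" for x by (simp add: u_def)
  have u3: "u x ^ 3 = cosh x" for x
    by (simp add: u_def exp_of_nat_mult[symmetric] cosh_real_pos)
  have du: "(u has_real_derivative u x * (sinh x / cosh x) / 3) (at x)" for x
    unfolding u_def by (auto intro!: derivative_eq_intros simp: cosh_real_pos)
  have "sinh z / u z - z \<ge> 0"
  proof (rule nonneg_if_deriv_nonneg_limit_0[OF assms])
    fix x :: real
    show "((\<lambda>x. sinh x / u x - x) has_real_derivative
        (u x ^ 2 - 1)\<^sup>2 * (2 * u x ^ 2 + 1) / (3 * u x ^ 4)) (at x)"
    proof -
      have s: "sinh x * sinh x = u x ^ 6 - 1"
      proof -
        have "u x ^ 6 = (u x ^ 3)\<^sup>2" by (simp flip: power_mult)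
        then show ?thesis
          using hyperbolic_pythagoras[of x] by (simp add: u3 power2_eq_square)
      qed
      have d: "((\<lambda>x. sinh x / u x - x) has_real_derivative
          (cosh x * u x - sinh x * (u x * (sinh x / cosh x) / 3)) / (u x * u x) - 1) (at x)"
        using u_pos[of x] du[of x] by (auto intro!: derivative_eq_intros)
      have "(cosh x * u x - sinh x * (u x * (sinh x / cosh x) / 3)) / (u x * u x) - 1
          = (u x ^ 3 * u x - u x * ((sinh x * sinh x) / u x ^ 3) / 3) / (u x * u x) - 1"
        by (simp add: u3)
      also have "\<dots> = (u x ^ 2 - 1)\<^sup>2 * (2 * u x ^ 2 + 1) / (3 * u x ^ 4)"
        unfolding s using u_pos[of x] by (simp add: field_simps) algebra
      finally show ?thesis using d by simp
    qed
    show "(u x ^ 2 - 1)\<^sup>2 * (2 * u x ^ 2 + 1) / (3 * u x ^ 4) \<ge> 0"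
      by simp
  next
    have "isCont (\<lambda>x. sinh x / u x - x) 0"
      using du[of 0] u_pos[of 0] by (auto intro!: continuous_intros dest: DERIV_isCont)
    then show "((\<lambda>x. sinh x / u x - x) \<longlongrightarrow> 0) (at_right 0)"
      by (auto simp: isCont_def intro: filterlim_at_within_not_equal dest: tendsto_mono[OF at_le, rotated])
  qed
  then have "z * u z \<le> sinh z" using u_pos[of z] by (simp add: field_simps)
  then have "(z * u z) ^ 3 \<le> sinh z ^ 3"
    using assms u_pos[of z] by (intro power_mono) auto
  then show ?thesis by (simp add: power_mult_distrib u3)
qed

text \<open>The second derivative is 2 (cosh x / sinh^3 x - 1 / x^3), whose sign is Lazarevic's
  inequality.\<close>

lemma langevin_concave: "concave_on {0<..} langevin"
proof (rule f''_le0_imp_concave)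
  fix x :: real assume "x \<in> {0<..}"
  then have x: "x > 0" "sinh x > 0" by auto
  have cs: "cosh x * cosh x = sinh x * sinh x + 1"
    using hyperbolic_pythagoras[of x] by (simp add: power2_eq_square)
  have "(langevin has_real_derivative (sinh x * sinh x - cosh x * cosh x) / (sinh x * sinh x) + 1 / x\<^sup>2) (at x)"
    unfolding langevin_def[abs_def] using x
    by (auto intro!: derivative_eq_intros simp: power2_eq_square)
  then show "(langevin has_real_derivative 1 / x\<^sup>2 - 1 / (sinh x)\<^sup>2) (at x)"
    unfolding cs by (simp add: power2_eq_square)
  show "((\<lambda>x. 1 / x\<^sup>2 - 1 / (sinh x)\<^sup>2) has_real_derivative 2 * cosh x / sinh x ^ 3 - 2 / x ^ 3) (at x)"
    using x by (auto intro!: derivative_eq_intros simp: field_simps power2_eq_square power3_eq_cube)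
  show "2 * cosh x / sinh x ^ 3 - 2 / x ^ 3 \<le> 0"
    using lazarevic[OF x(1)] x by (simp add: field_simps)
qed simp

text \<open>With weights T_i / D and points z_i = T_i t / 2, the left side is t D / 2 times the
  weighted mean of \<open>ell (2 * z) / z\<close>, and the weighted mean of the points is b = V t /
  (2 D). Jensen's inequality for the two summands \<open>ln_sinhc z / z\<close> and
  \<open>langevin z\<close> bounds this mean by the value at b.\<close>

lemma sum_ell_le:
  fixes T :: "'i \<Rightarrow> real"
  assumes "finite I" "I \<noteq> {}" and T: "\<And>i. i \<in> I \<Longrightarrow> T i > 0" and "t \<ge> 0"
  shows "(\<Sum>i\<in>I. ell (T i * t)) \<le> (\<Sum>i\<in>I. T i)\<^sup>2 / (\<Sum>i\<in>I. (T i)\<^sup>2) *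
    ell ((\<Sum>i\<in>I. (T i)\<^sup>2) * t / (\<Sum>i\<in>I. T i))"
proof (cases "t = 0")
  case True
  then show ?thesis by (simp add: ell_def)
next
  case False
  with \<open>t \<ge> 0\<close> have t: "t > 0" by simp
  define D where "D = (\<Sum>i\<in>I. T i)"
  define V where "V = (\<Sum>i\<in>I. (T i)\<^sup>2)"
  have D: "D > 0" unfolding D_def using assms(1,2) T by (intro sum_pos) auto
  have V: "V > 0" unfolding V_def using assms(1,2) T by (intro sum_pos) (auto dest: T)
  define z where "z = (\<lambda>i. T i * t / 2)"
  define w where "w = (\<lambda>i. T i / D)"
  define b where "b = V * t / (2 * D)"
  have z: "z i > 0" if "i \<in> I" for i using T[OF that] t by (simp add: z_def)
  have w: "w i \<ge> 0" if "i \<in> I" for i using T[OF that] D by (simp add: w_def less_imp_le)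
  have w_sum: "sum w I = 1" using D by (simp add: w_def D_def flip: sum_divide_distrib)
  have b: "b > 0" using V D t by (simp add: b_def)
  have b_eq: "(\<Sum>i\<in>I. w i * z i) = b"
    unfolding w_def z_def b_def V_def sum_distrib_right sum_divide_distrib
    by (intro sum.cong refl) (simp add: power2_eq_square)
  have jensen: "(\<Sum>i\<in>I. w i * langevin (s * z i)) \<le> langevin (s * b)" if "s > 0" for s
  proof -
    have "(\<Sum>i\<in>I. w i * langevin (s * z i)) \<le> langevin (\<Sum>i\<in>I. w i *\<^sub>R (s * z i))"
      using assms(1,2) langevin_concave w_sum w z that by (intro concave_on_sum) auto
    also have "(\<Sum>i\<in>I. w i *\<^sub>R (s * z i)) = s * b"
      by (simp add: b_eq[symmetric] sum_distrib_left mult_ac)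
    finally show ?thesis .
  qed
  \<comment> \<open>\<open>ln_sinhc z / z\<close> is the mean of \<open>langevin\<close> over \<open>{0..z}\<close>, so Jensen's inequality for
    \<open>langevin\<close> at every scale \<open>s\<close> integrates to Jensen's inequality for \<open>ln_sinhc z / z\<close>.\<close>
  have "ln_sinhc (1 * b) / b - (\<Sum>i\<in>I. w i * (ln_sinhc (1 * z i) / z i)) \<ge> 0"
  proof (rule nonneg_if_deriv_nonneg_limit_0[where b = 1 and
        g = "\<lambda>s. ln_sinhc (s * b) / b - (\<Sum>i\<in>I. w i * (ln_sinhc (s * z i) / z i))" and
        g' = "\<lambda>s. langevin (s * b) - (\<Sum>i\<in>I. w i * langevin (s * z i))"])
    fix s :: real assume s: "0 < s"
    have 1: "((\<lambda>s. ln_sinhc (s * c) / c) has_real_derivative langevin (s * c)) (at s)" if "c > 0" for c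
    proof -
      have "((\<lambda>s. s * c) has_real_derivative c) (at s)" by (auto intro!: derivative_eq_intros)
      from DERIV_cdivide[OF DERIV_chain2[OF ln_sinhc_deriv this], of c]
      show "((\<lambda>s. ln_sinhc (s * c) / c) has_real_derivative langevin (s * c)) (at s)"
        using that s by simp
    qed
    show "((\<lambda>s. ln_sinhc (s * b) / b - (\<Sum>i\<in>I. w i * (ln_sinhc (s * z i) / z i)))
        has_real_derivative langevin (s * b) - (\<Sum>i\<in>I. w i * langevin (s * z i))) (at s)"
      using b z by (intro DERIV_diff DERIV_sum DERIV_cmult 1) auto
    show "0 \<le> langevin (s * b) - (\<Sum>i\<in>I. w i * langevin (s * z i))"
      using jensen[OF s] by simp
  next
    have "((\<lambda>s. ln_sinhc (s * c) / c) \<longlongrightarrow> 0) (at_right 0)" if "c > 0" for c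
    proof -
      have "((\<lambda>s. ln_sinhc (s * c)) \<longlongrightarrow> 0) (at_right 0)"
        by (rule filterlim_compose[OF ln_sinhc_tendsto_0]) (use that in real_asymp)
      from tendsto_divide[OF this tendsto_const[of c]] show ?thesis using that by simp
    qed
    then have "((\<lambda>s. ln_sinhc (s * b) / b - (\<Sum>i\<in>I. w i * (ln_sinhc (s * z i) / z i)))
        \<longlongrightarrow> 0 - (\<Sum>i\<in>I. w i * 0)) (at_right 0)"
      using b z by (intro tendsto_diff tendsto_sum tendsto_mult_left) auto
    then show "((\<lambda>s. ln_sinhc (s * b) / b - (\<Sum>i\<in>I. w i * (ln_sinhc (s * z i) / z i))) \<longlongrightarrow> 0)
        (at_right 0)"
      by simp
  qed simp
  then have *: "(\<Sum>i\<in>I. w i * (ln_sinhc (z i) / z i + langevin (z i))) \<le> ln_sinhc b / b + langevin b"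
    using jensen[of 1] by (simp add: distrib_left sum.distrib)
  have "(\<Sum>i\<in>I. ell (T i * t)) = (\<Sum>i\<in>I. (t * D / 2) * (w i * (ln_sinhc (z i) / z i + langevin (z i))))"
  proof (rule sum.cong)
    fix i assume i: "i \<in> I"
    have "ell (T i * t) = z i * (ln_sinhc (z i) / z i + langevin (z i))"
    proof -
      have "T i * t = 2 * z i" by (simp add: z_def)
      then show ?thesis using ell_eq_langevin[OF z[OF i]] z[OF i] by (simp add: distrib_left)
    qed
    also have "\<dots> = (t * D / 2) * (w i * (ln_sinhc (z i) / z i + langevin (z i)))"
    proof -
      have "z i = (t * D / 2) * w i" using D by (simp add: z_def w_def)
      then show ?thesis by (metis mult.assoc)
    qed
    finally show "ell (T i * t) = (t * D / 2) * (w i * (ln_sinhc (z i) / z i + langevin (z i)))" .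
  qed simp
  also have "\<dots> \<le> (t * D / 2) * (ln_sinhc b / b + langevin b)"
    unfolding sum_distrib_left[symmetric] using * t D by (intro mult_left_mono) auto
  also have "\<dots> = (t * D / 2) / b * ell (2 * b)"
    using b ell_eq_langevin[OF b] by (simp add: field_simps)
  also have "\<dots> = D\<^sup>2 / V * ell (V * t / D)"
    using t V D by (simp add: b_def field_simps power2_eq_square)
  finally show ?thesis unfolding D_def V_def .
qed

lemma ln_bernoulli_mgf_le_ell:
  fixes p u :: real
  assumes "0 \<le> p" "p \<le> 1" "u \<ge> 0"
  shows "ln (1 - p + p * exp u) - p * u \<le> ell u"
proof (cases "u = 0")
  case True
  then show ?thesis by (simp add: ell_def)
next
  case False
  with assms have u: "u > 0" by simp
  \<comment> \<open>The maximum over p of ln (1 - p + p e^u) - p u is attained where 1 - p + p e^u =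
    x0. Hence the tangent of ln at x0 gives the sharp bound, and its slope 1 / x0 makes the
    dependence on p cancel.\<close>
  define x0 where "x0 = (exp u - 1) / u"
  have e: "exp u > 1" using u by simp
  have x0: "x0 > 0" using u e by (simp add: x0_def)
  have x: "1 - p + p * exp u > 0"
    using assms e by (smt (verit) mult_le_cancel_left1)
  have "ln (1 - p + p * exp u) - ln x0 = ln ((1 - p + p * exp u) / x0)"
    using x x0 by (simp add: ln_div)
  also have "\<dots> \<le> (1 - p + p * exp u) / x0 - 1"
    using x x0 by (intro ln_le_minus_one) simp
  also have "\<dots> = (1 + p * (exp u - 1)) / (exp u - 1) * u - 1"
    by (simp add: x0_def algebra_simps)
  also have "\<dots> = u * inverse (exp u - 1) + p * u - 1"
    using e by (simp add: field_simps)
  finally have 1: "ln (1 - p + p * exp u) - p * u \<le> ln x0 + u * inverse (exp u - 1) - 1" by simp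
  have "x0 = exp u * (1 - exp (- u)) / u"
    by (simp add: x0_def right_diff_distrib flip: exp_add)
  then have "ln x0 = u + ln (1 - exp (- u)) - ln u"
    using u by (simp add: ln_div ln_mult)
  then show ?thesis using 1 u by (simp add: ell_def)
qed

section \<open>The Legendre transform of \<open>\<ell>\<close>\<close>

text \<open>By this Riccati equation for \<open>L\<close>, a bound on \<open>L\<close> integrates to the next Taylor bound,
  with \<open>L(z) = z/3 - z\<^sup>3/45 + 2 z\<^sup>5/945 - \<dots>\<close>.\<close>

lemma langevin_riccati:
  assumes "z > 0"
  shows "((\<lambda>z. z\<^sup>2 * langevin z) has_real_derivative z\<^sup>2 * (1 - (langevin z)\<^sup>2)) (at z)"
proof -
  have cs: "cosh z ^ 2 = sinh z ^ 2 + 1"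
    using hyperbolic_pythagoras[of z] by simp
  have "sinh z > 0" using assms by simp
  then have "((\<lambda>z. z\<^sup>2 * langevin z) has_real_derivative
      2 * z * langevin z + z\<^sup>2 * ((sinh z ^ 2 - cosh z ^ 2) / sinh z ^ 2 + 1 / z\<^sup>2)) (at z)"
    unfolding langevin_def using assms
    by (auto intro!: derivative_eq_intros simp: power2_eq_square)
  also have "2 * z * langevin z + z\<^sup>2 * ((sinh z ^ 2 - cosh z ^ 2) / sinh z ^ 2 + 1 / z\<^sup>2)
      = z\<^sup>2 * (1 - (langevin z)\<^sup>2)"
    using assms \<open>sinh z > 0\<close> cs unfolding langevin_def by (simp add: field_simps power2_eq_square)
  finally show ?thesis .
qed

lemma square_langevin_tendsto_0: "((\<lambda>z. z\<^sup>2 * langevin z) \<longlongrightarrow> 0) (at_right 0)"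
  unfolding langevin_def[abs_def] sinh_field_def cosh_field_def by real_asymp

section \<open>Taylor bounds for the Langevin function and \<open>ell\<close> near 0\<close>

lemma langevin_nonneg:
  assumes "z > 0"
  shows "langevin z \<ge> 0"
proof -
  have "z * cosh z - sinh z \<ge> 0"
  proof (rule nonneg_if_deriv_nonneg_limit_0[OF assms, where g' = "\<lambda>z. z * sinh z"])
    show "((\<lambda>z::real. z * cosh z - sinh z) \<longlongrightarrow> 0) (at_right 0)"
      unfolding sinh_field_def cosh_field_def by real_asymp
  qed (auto intro!: derivative_eq_intros)
  then show ?thesis using assms by (simp add: langevin_def field_simps)
qed

lemma langevin_le_third:
  assumes "z > 0"
  shows "langevin z \<le> z / 3"
proof -
  have "z ^ 3 / 3 - z\<^sup>2 * langevin z \<ge> 0"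
  proof (rule nonneg_if_deriv_nonneg_limit_0[OF assms, where g' = "\<lambda>z. z\<^sup>2 * (langevin z)\<^sup>2"])
    show "((\<lambda>z::real. z ^ 3 / 3 - z\<^sup>2 * langevin z) \<longlongrightarrow> 0) (at_right 0)"
      by (rule tendsto_eq_intros square_langevin_tendsto_0 | simp)+
  next
    fix z :: real assume z: "0 < z"
    have "((\<lambda>z. z ^ 3 / 3 - z\<^sup>2 * langevin z) has_real_derivative z\<^sup>2 - z\<^sup>2 * (1 - (langevin z)\<^sup>2)) (at z)"
      by (intro DERIV_diff langevin_riccati z) (auto intro!: derivative_eq_intros)
    then show "((\<lambda>z. z ^ 3 / 3 - z\<^sup>2 * langevin z) has_real_derivative z\<^sup>2 * (langevin z)\<^sup>2) (at z)"
      by (simp add: algebra_simps)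
  qed auto
  then have "z\<^sup>2 * langevin z \<le> z\<^sup>2 * (z / 3)" by (simp add: power2_eq_square power3_eq_cube)
  then show ?thesis using assms by simp
qed

lemma langevin_ge_cubic:
  assumes "z > 0"
  shows "langevin z \<ge> z / 3 - z ^ 3 / 45"
proof -
  have "z\<^sup>2 * langevin z - (z ^ 3 / 3 - z ^ 5 / 45) \<ge> 0"
  proof (rule nonneg_if_deriv_nonneg_limit_0[OF assms, where g' = "\<lambda>z. z\<^sup>2 * ((z / 3)\<^sup>2 - (langevin z)\<^sup>2)"])
    show "((\<lambda>z::real. z\<^sup>2 * langevin z - (z ^ 3 / 3 - z ^ 5 / 45)) \<longlongrightarrow> 0) (at_right 0)"
      by (rule tendsto_eq_intros square_langevin_tendsto_0 | simp)+
  next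
    fix z :: real assume z: "0 < z"
    have "((\<lambda>z. z\<^sup>2 * langevin z - (z ^ 3 / 3 - z ^ 5 / 45)) has_real_derivative
        z\<^sup>2 * (1 - (langevin z)\<^sup>2) - (z\<^sup>2 - z ^ 4 / 9)) (at z)"
      by (intro DERIV_diff langevin_riccati z) (auto intro!: derivative_eq_intros)
    then show "((\<lambda>z. z\<^sup>2 * langevin z - (z ^ 3 / 3 - z ^ 5 / 45)) has_real_derivative
        z\<^sup>2 * ((z / 3)\<^sup>2 - (langevin z)\<^sup>2)) (at z)"
      by (simp add: algebra_simps eval_nat_numeral)
    show "z\<^sup>2 * ((z / 3)\<^sup>2 - (langevin z)\<^sup>2) \<ge> 0"
      using power_mono[OF langevin_le_third[OF z] langevin_nonneg[OF z], of 2] by simp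
  qed
  then have "z\<^sup>2 * (z / 3 - z ^ 3 / 45) \<le> z\<^sup>2 * langevin z"
    by (simp add: algebra_simps eval_nat_numeral)
  then show ?thesis using assms by simp
qed

text \<open>The square of z/3 - z^3/45 is z^2/9 - 2 z^4/135 + z^6/2025. Dropping its last term and
  integrating the Riccati equation yields the coefficient 2/945 = 2/(7 * 135). For z <= 1 the
  resulting term is absorbed because 1/45 - 2/945 >= 1/50.\<close>

lemma langevin_le_cubic:
  assumes "0 < z" "z \<le> 1"
  shows "langevin z \<le> z / 3 - z ^ 3 / 50"
proof -
  have "(z ^ 3 / 3 - z ^ 5 / 45 + 2 * z ^ 7 / 945) - z\<^sup>2 * langevin z \<ge> 0"
  proof (rule nonneg_if_deriv_nonneg_limit_0[OF assms(1), where
        g' = "\<lambda>z. z\<^sup>2 * ((langevin z)\<^sup>2 - (z / 3 - z ^ 3 / 45)\<^sup>2 + z ^ 6 / 2025)"])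
    show "((\<lambda>z::real. (z ^ 3 / 3 - z ^ 5 / 45 + 2 * z ^ 7 / 945) - z\<^sup>2 * langevin z) \<longlongrightarrow> 0) (at_right 0)"
      by (rule tendsto_eq_intros square_langevin_tendsto_0 | simp)+
  next
    fix x :: real assume x: "0 < x" "x \<le> z"
    have "((\<lambda>z. (z ^ 3 / 3 - z ^ 5 / 45 + 2 * z ^ 7 / 945) - z\<^sup>2 * langevin z) has_real_derivative
        (x\<^sup>2 - x ^ 4 / 9 + 2 * x ^ 6 / 135) - x\<^sup>2 * (1 - (langevin x)\<^sup>2)) (at x)"
      by (intro DERIV_diff langevin_riccati x) (auto intro!: derivative_eq_intros)
    then show "((\<lambda>z. (z ^ 3 / 3 - z ^ 5 / 45 + 2 * z ^ 7 / 945) - z\<^sup>2 * langevin z) has_real_derivative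
        x\<^sup>2 * ((langevin x)\<^sup>2 - (x / 3 - x ^ 3 / 45)\<^sup>2 + x ^ 6 / 2025)) (at x)"
      by (simp add: algebra_simps eval_nat_numeral)
    \<comment> \<open>This keeps x/3 - x^3/45 nonnegative, so that the lower bound may be
      squared.\<close>
    have "x ^ 3 \<le> x" using x assms power_decreasing[of 1 3 x] by simp
    then have "(x / 3 - x ^ 3 / 45)\<^sup>2 \<le> (langevin x)\<^sup>2"
      using langevin_ge_cubic[OF x(1)] x by (intro power_mono) auto
    then show "x\<^sup>2 * ((langevin x)\<^sup>2 - (x / 3 - x ^ 3 / 45)\<^sup>2 + x ^ 6 / 2025) \<ge> 0"
      using x by (intro mult_nonneg_nonneg) auto
  qed
  then have "z\<^sup>2 * langevin z \<le> z\<^sup>2 * (z / 3 - z ^ 3 / 45 + 2 * z ^ 5 / 945)"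
    by (simp add: algebra_simps eval_nat_numeral)
  then have "langevin z \<le> z / 3 - z ^ 3 / 45 + 2 * z ^ 5 / 945" using assms by simp
  moreover have "z ^ 5 \<le> z ^ 3" "z ^ 3 > 0" using assms by (auto intro: power_decreasing)
  ultimately show ?thesis by linarith
qed

text \<open>Integrating the cubic bound gives \<open>ln_sinhc z\<close> <= z^2/6 - z^4/200, and
  multiplying it by z gives z^2/3 - z^4/50 for the other summand of
  \<open>ell_eq_langevin\<close>.\<close>

lemma ell_le_quartic:
  assumes "0 < z" "z \<le> 1"
  shows "ell (2 * z) \<le> z\<^sup>2 / 2 - z ^ 4 / 40"
proof -
  have "(z\<^sup>2 / 6 - z ^ 4 / 200) - ln_sinhc z \<ge> 0"
  proof (rule nonneg_if_deriv_nonneg_limit_0[OF assms(1), where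
        g' = "\<lambda>z. (z / 3 - z ^ 3 / 50) - langevin z"])
    show "((\<lambda>z. (z\<^sup>2 / 6 - z ^ 4 / 200) - ln_sinhc z) \<longlongrightarrow> 0) (at_right 0)"
      by (rule tendsto_eq_intros ln_sinhc_tendsto_0 | simp)+
  next
    fix x :: real assume x: "0 < x" "x \<le> z"
    show "((\<lambda>z. (z\<^sup>2 / 6 - z ^ 4 / 200) - ln_sinhc z) has_real_derivative
        (x / 3 - x ^ 3 / 50) - langevin x) (at x)"
      by (intro DERIV_diff ln_sinhc_deriv x) (auto intro!: derivative_eq_intros)
    show "(x / 3 - x ^ 3 / 50) - langevin x \<ge> 0"
      using langevin_le_cubic[of x] x assms by simp
  qed
  moreover have "z * langevin z \<le> z * (z / 3 - z ^ 3 / 50)"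
    using langevin_le_cubic[OF assms] assms by (intro mult_left_mono) auto
  then have "z * langevin z \<le> z\<^sup>2 / 3 - z ^ 4 / 50"
    by (simp add: algebra_simps eval_nat_numeral)
  ultimately show ?thesis
    unfolding ell_eq_langevin[OF assms(1)] by simp
qed

text \<open>Since \<open>ell t\<close> behaves like t^2/8 near 0, t = 4y maximises y t -
  \<open>ell t\<close> to leading order. The quartic bound at z = 2y leaves at least 2 y^2 + (2/5)
  y^4 on the right, which reduces the claim to -ln (1 - y) <= (2 y + (2/5) y^3) / (2 - y). The
  factor 1/2 - y in the derivative of the difference is where the range of y enters.\<close>

lemma rate_le_at_4y:
  assumes "0 < y" "y \<le> 1/2"
  shows "(y\<^sup>2 - 2 * y) * ln (1 - y) \<le> y * (4 * y) - ell (4 * y)"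
proof -
  have "(2 * y + 2 / 5 * y ^ 3) / (2 - y) + ln (1 - y) \<ge> 0"
  proof (rule nonneg_if_deriv_nonneg_limit_0[OF assms(1), where
        g' = "\<lambda>y. y\<^sup>2 * ((4 / 5) * (1 / 2 - y) * (7 / 2 - y)) / ((2 - y)\<^sup>2 * (1 - y))"])
    have "isCont (\<lambda>y::real. (2 * y + 2 / 5 * y ^ 3) / (2 - y) + ln (1 - y)) 0"
      by (auto intro!: continuous_intros)
    then show "((\<lambda>y::real. (2 * y + 2 / 5 * y ^ 3) / (2 - y) + ln (1 - y)) \<longlongrightarrow> 0) (at_right 0)"
      by (auto simp: isCont_def dest: tendsto_mono[OF at_le, rotated])
  next
    fix x :: real assume x: "0 < x" "x \<le> y"
    then have x': "2 - x > 0" "1 - x > 0" using assms by auto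
    have "((\<lambda>y. (2 * y + 2 / 5 * y ^ 3) / (2 - y) + ln (1 - y)) has_real_derivative
       ((2 + 6 / 5 * x\<^sup>2) * (2 - x) + (2 * x + 2 / 5 * x ^ 3)) / ((2 - x) * (2 - x)) - 1 / (1 - x)) (at x)"
      using x' by (auto intro!: derivative_eq_intros)
    also have "((2 + 6 / 5 * x\<^sup>2) * (2 - x) + (2 * x + 2 / 5 * x ^ 3)) / ((2 - x) * (2 - x)) - 1 / (1 - x)
       = x\<^sup>2 * ((4 / 5) * (1 / 2 - x) * (7 / 2 - x)) / ((2 - x)\<^sup>2 * (1 - x))"
      using x' by (simp add: divide_simps) algebra
    finally show "((\<lambda>y. (2 * y + 2 / 5 * y ^ 3) / (2 - y) + ln (1 - y)) has_real_derivative
       x\<^sup>2 * ((4 / 5) * (1 / 2 - x) * (7 / 2 - x)) / ((2 - x)\<^sup>2 * (1 - x))) (at x)" .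
    show "x\<^sup>2 * ((4 / 5) * (1 / 2 - x) * (7 / 2 - x)) / ((2 - x)\<^sup>2 * (1 - x)) \<ge> 0"
      using x x' assms by (intro divide_nonneg_nonneg mult_nonneg_nonneg) auto
  qed
  then have "- ln (1 - y) \<le> (2 * y + 2 / 5 * y ^ 3) / (2 - y)" by simp
  then have "(2 * y - y\<^sup>2) * (- ln (1 - y)) \<le> (2 * y - y\<^sup>2) * ((2 * y + 2 / 5 * y ^ 3) / (2 - y))"
    using assms by (intro mult_left_mono) (auto simp: power2_eq_square)
  also have "2 * y - y\<^sup>2 = y * (2 - y)" by (simp add: power2_eq_square algebra_simps)
  also have "y * (2 - y) * ((2 * y + 2 / 5 * y ^ 3) / (2 - y)) = 2 * y\<^sup>2 + 2 / 5 * y ^ 4"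
    using assms by (simp add: nonzero_eq_divide_eq) algebra
  finally have 1: "y * (2 - y) * (- ln (1 - y)) \<le> 2 * y\<^sup>2 + 2 / 5 * y ^ 4" .
  have "ell (2 * (2 * y)) \<le> (2 * y)\<^sup>2 / 2 - (2 * y) ^ 4 / 40"
    using assms by (intro ell_le_quartic) auto
  with 1 show ?thesis by (simp add: power2_eq_square algebra_simps)
qed

section \<open>The bound on \<open>ell\<close> for large arguments\<close>

lemma exp_2_ge: "exp 2 \<ge> (369 / 50 :: real)"
proof -
  have "(\<Sum>k<10. inverse (fact k) *\<^sub>R (2::real) ^ k) \<le> (\<Sum>k. inverse (fact k) *\<^sub>R 2 ^ k)"
    by (intro sum_le_suminf summable_exp_generic) auto
  then show ?thesis by (simp add: exp_def fact_numeral lessThan_nat_numeral)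
qed

lemma ln_2_ge: "ln 2 \<ge> (56 / 81 :: real)"
  using ln_approx_bounds[of 2 2, simplified, simplified eval_nat_numeral, simplified] by simp

lemma ln_one_plus_ge_quadratic:
  fixes w :: real
  assumes "w \<ge> 0"
  shows "ln (1 + w) \<ge> w - w\<^sup>2 / 2"
proof -
  have "ln (1 + 0) - (0 - 0\<^sup>2 / 2) \<le> ln (1 + w) - (w - w\<^sup>2 / 2)"
  proof (rule DERIV_nonneg_imp_nondecreasing[OF assms])
    fix x :: real assume x: "0 \<le> x"
    then have "((\<lambda>w. ln (1 + w) - (w - w\<^sup>2 / 2)) has_real_derivative x\<^sup>2 / (1 + x)) (at x)"
      by (auto intro!: derivative_eq_intros simp: field_simps power2_eq_square)
    then show "\<exists>y. ((\<lambda>w. ln (1 + w) - (w - w\<^sup>2 / 2)) has_real_derivative y) (at x) \<and> 0 \<le> y"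
      using x by (intro exI[of _ "x\<^sup>2 / (1 + x)"]) simp
  qed
  then show ?thesis by simp
qed

text \<open>This is the derivative estimate of \<open>ell_le_large\<close>, multiplied by u^2. With
  A the coefficient of u on the left, u^2 - A u increases beyond A/2, so it suffices to check the
  claim at a lower bound u0 of u with 2 u0 >= A.\<close>

lemma ell_remainder_deriv_bound:
  fixes t :: real
  assumes "t \<ge> 2"
  defines "u \<equiv> exp t - 1"
  shows "t\<^sup>2 * (4 * t - t\<^sup>2 - 2) * u - t\<^sup>2 * (t\<^sup>2 - 1) \<le> u\<^sup>2"
proof -
  define s where "s = t - 2"
  \<comment> \<open>Here u0 + 1 = (369/50) (1 + s + s^2/2), a lower bound for e^t = e^2 e^s.\<close>
  define u0 where "u0 = 319 / 50 + 369 / 50 * s + 369 / 100 * s\<^sup>2"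
  define A where "A = t\<^sup>2 * (4 * t - t\<^sup>2 - 2)"
  have s: "s \<ge> 0" and t: "t = 2 + s" using assms by (auto simp: s_def)
  have "(369 / 50) * (1 + s + s\<^sup>2 / 2) \<le> exp 2 * exp s"
    using exp_2_ge exp_lower_Taylor_quadratic[OF s] s by (intro mult_mono) auto
  then have u: "u \<ge> u0"
    by (simp add: u_def u0_def t algebra_simps exp_add)
  have A: "A \<le> 8 + 8 * s - 2 * s\<^sup>2"
  proof -
    have "A = 8 + 8 * s - 2 * s\<^sup>2 - 4 * s ^ 3 - s ^ 4"
      unfolding A_def t by (simp add: algebra_simps eval_nat_numeral)
    moreover have "s ^ 3 \<ge> 0" "s ^ 4 \<ge> 0" using s by auto
    ultimately show ?thesis by linarith
  qed
  have B: "t\<^sup>2 * (t\<^sup>2 - 1) \<ge> 12 + 28 * s"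
  proof -
    have "t\<^sup>2 * (t\<^sup>2 - 1) = 12 + 28 * s + 23 * s\<^sup>2 + 8 * s ^ 3 + s ^ 4"
      unfolding t by (simp add: algebra_simps eval_nat_numeral)
    moreover have "s\<^sup>2 \<ge> 0" "s ^ 3 \<ge> 0" "s ^ 4 \<ge> 0" using s by auto
    ultimately show ?thesis using s by linarith
  qed
  have u0: "u0 \<ge> 0" using s by (auto simp: u0_def intro!: add_nonneg_nonneg)
  have u0A: "u0 + u0 \<ge> A" using s A zero_le_power2[of s] unfolding u0_def by linarith
  have "u0 * (A - u0) \<le> u0 * ((8 + 8 * s - 2 * s\<^sup>2) - u0)"
    using A u0 by (intro mult_left_mono) auto
  also have "\<dots> \<le> 12 + 28 * s"
  proof -
    have "(12 + 28 * s) - u0 * ((8 + 8 * s - 2 * s\<^sup>2) - u0)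
      = 4161 / 2500 + 15111 / 1250 * s + 16093 / 625 * s\<^sup>2 + 99261 / 2500 * s ^ 3 + 209961 / 10000 * s ^ 4"
      unfolding u0_def by (simp add: algebra_simps eval_nat_numeral)
    moreover have "s\<^sup>2 \<ge> 0" "s ^ 3 \<ge> 0" "s ^ 4 \<ge> 0" using s by auto
    ultimately show ?thesis using s by linarith
  qed
  finally have "u0 * (A - u0) \<le> t\<^sup>2 * (t\<^sup>2 - 1)" using B by simp
  moreover have "(u - u0) * (u + u0 - A) \<ge> 0"
    using u u0 u0A by (intro mult_nonneg_nonneg) auto
  ultimately show ?thesis
    unfolding A_def[symmetric] by (simp add: algebra_simps power2_eq_square)
qed

text \<open>With w = 1 / (e^t - 1) one has ln (1 - e^(-t)) = -ln (1 + w), so the claim says r t <=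
  ln t / t^2. The function ln t - t^2 r t is nonnegative at 2 and nondecreasing from there
  on.\<close>

lemma ell_le_large:
  fixes t :: real
  assumes "t \<ge> 2"
  shows "ell t \<le> t - ln t - 1 + ln t / t\<^sup>2"
proof -
  define w where "w = (\<lambda>t::real. inverse (exp t - 1))"
  define r where "r = (\<lambda>t. t * w t - ln (1 + w t))"
  have w: "w x > 0" if "x > 0" for x using that by (simp add: w_def)
  have dw: "(w has_real_derivative - (w x + (w x)\<^sup>2)) (at x)" if "x > 0" for x
  proof -
    have *: "exp x - 1 > 0" using that by simp
    then have "(w has_real_derivative - (exp x) * (w x)\<^sup>2) (at x)"
      unfolding w_def by (auto intro!: derivative_eq_intros simp: power2_eq_square)
    also have "- (exp x) * (w x)\<^sup>2 = - (w x + (w x)\<^sup>2)"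
    proof -
      have "exp x * w x = 1 + w x" using * by (simp add: w_def field_simps)
      then have "exp x * w x * w x = (1 + w x) * w x" by simp
      then show ?thesis by (simp add: power2_eq_square algebra_simps)
    qed
    finally show "(w has_real_derivative - (w x + (w x)\<^sup>2)) (at x)" .
  qed
  have dr: "(r has_real_derivative w x * (2 - x - x * w x)) (at x)" if "x > 0" for x
  proof -
    have "(r has_real_derivative w x + x * (- (w x + (w x)\<^sup>2)) - (- (w x + (w x)\<^sup>2)) / (1 + w x)) (at x)"
      unfolding r_def using w[OF that] by (auto intro!: derivative_eq_intros dw that)
    also have "(- (w x + (w x)\<^sup>2)) / (1 + w x) = - w x"
      using w[OF that] by (simp add: field_simps power2_eq_square)
    finally show "(r has_real_derivative w x * (2 - x - x * w x)) (at x)"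
      by (simp add: algebra_simps power2_eq_square)
  qed
  have "ln 2 - 2\<^sup>2 * r 2 \<le> ln t - t\<^sup>2 * r t"
  proof (rule DERIV_nonneg_imp_nondecreasing[OF assms])
    fix x :: real assume x: "2 \<le> x"
    define u where "u = exp x - 1"
    have u: "u > 0" "w x = 1 / u" using x by (simp_all add: u_def w_def divide_inverse)
    define d where "d = 1 / x - (2 * x * r x + x\<^sup>2 * (w x * (2 - x - x * w x)))"
    have "((\<lambda>t. ln t - t\<^sup>2 * r t) has_real_derivative d) (at x)"
      unfolding d_def using x by (auto intro!: derivative_eq_intros dr)
    moreover have "d \<ge> 0"
    proof -
      \<comment> \<open>The quadratic lower bound for ln (1 + w) bounds x d from below by a
        polynomial in x and w = 1/u.\<close>
      have "r x \<le> x * w x - w x + (w x)\<^sup>2 / 2"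
        using ln_one_plus_ge_quadratic[of "w x"] w[of x] x by (simp add: r_def)
      then have "2 * x\<^sup>2 * r x \<le> 2 * x\<^sup>2 * (x * w x - w x + (w x)\<^sup>2 / 2)"
        using x by (intro mult_left_mono) auto
      then have "x * d \<ge> 1 - (x\<^sup>2 * (4 * x - x\<^sup>2 - 2) * w x - x\<^sup>2 * (x\<^sup>2 - 1) * (w x)\<^sup>2)"
        using x by (simp add: d_def algebra_simps eval_nat_numeral)
      also have "x\<^sup>2 * (4 * x - x\<^sup>2 - 2) * w x - x\<^sup>2 * (x\<^sup>2 - 1) * (w x)\<^sup>2
          = (x\<^sup>2 * (4 * x - x\<^sup>2 - 2) * u - x\<^sup>2 * (x\<^sup>2 - 1)) / u\<^sup>2"
        unfolding u(2) using u(1) by (simp add: field_simps power2_eq_square)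
      also have "1 - \<dots> \<ge> 0"
        using ell_remainder_deriv_bound[OF x] u by (simp add: u_def)
      finally show ?thesis using x by (simp add: zero_le_mult_iff)
    qed
    ultimately show "\<exists>d. ((\<lambda>t. ln t - t\<^sup>2 * r t) has_real_derivative d) (at x) \<and> 0 \<le> d" by blast
  qed
  moreover have "ln 2 - 2\<^sup>2 * r 2 \<ge> 0"
  proof -
    have "w 2 \<le> inverse (319 / 50)"
      unfolding w_def using exp_2_ge by (intro le_imp_inverse_le) auto
    then have w2: "w 2 \<le> 50 / 319" by simp
    have "(w 2)\<^sup>2 \<le> (50 / 319)\<^sup>2" using w2 w[of 2] by (intro power_mono) auto
    moreover have "r 2 \<le> w 2 + (w 2)\<^sup>2 / 2"
      using ln_one_plus_ge_quadratic[of "w 2"] w[of 2] by (simp add: r_def)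
    ultimately show ?thesis using w2 ln_2_ge by (simp add: power2_eq_square)
  qed
  ultimately have "r t \<le> ln t / t\<^sup>2" using assms by (simp add: field_simps)
  moreover have "ln (1 - exp (- t)) = - ln (1 + w t)"
  proof -
    have "1 - exp (- t) = inverse (1 + w t)"
      using assms by (simp add: w_def exp_minus field_simps)
    then show ?thesis using w[of t] assms by (simp add: ln_inverse)
  qed
  ultimately show ?thesis using assms by (simp add: ell_def r_def w_def)
qed

lemma ell_star_ge:
  assumes "0 < y" "y < 1"
  shows "ereal ((y\<^sup>2 - 2 * y) * ln (1 - y)) \<le> ell_star y"
proof (cases "y \<le> 1/2")
  case True
  have "ereal ((y\<^sup>2 - 2 * y) * ln (1 - y)) \<le> ereal (y * (4 * y) - ell (4 * y))"
    using rate_le_at_4y[OF assms(1) True] by simp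
  also have "\<dots> \<le> ell_star y"
    unfolding ell_star_def using assms by (intro SUP_upper) auto
  finally show ?thesis .
next
  case False
  \<comment> \<open>This t maximises y t - (t - ln t - 1), where t - ln t - 1 is the main part of
    \<open>ell t\<close> for large t. The error ln t / t^2 is then -(1 - y)^2 ln (1 - y), and 1 - (1
    - y)^2 = 2 y - y^2 produces exactly the claimed rate.\<close>
  define t where "t = 1 / (1 - y)"
  have t: "t \<ge> 2" using False assms by (simp add: t_def field_simps)
  have ln: "ln t = - ln (1 - y)" using assms by (simp add: t_def ln_div)
  have "y * t = t - 1" using assms by (simp add: t_def field_simps)
  then have "y * t - ell t \<ge> ln t - ln t / t\<^sup>2"
    using ell_le_large[OF t] by simp
  also have "ln t - ln t / t\<^sup>2 = (y\<^sup>2 - 2 * y) * ln (1 - y)"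
    unfolding ln by (simp add: t_def power2_eq_square algebra_simps)
  finally have "ereal ((y\<^sup>2 - 2 * y) * ln (1 - y)) \<le> ereal (y * t - ell t)" by simp
  also have "\<dots> \<le> ell_star y"
    unfolding ell_star_def using t by (intro SUP_upper) auto
  finally show ?thesis .
qed

text \<open>By \<open>ell_le_large\<close>, t - \<open>ell t\<close> is at least 1 + ln t - ln t /
  t^2, which is unbounded. This settles the endpoint x = D of the explicit tail bound.\<close>

lemma ell_star_1: "ell_star 1 = \<infinity>"
proof (rule ereal_top)
  fix B :: real
  define t where "t = max 2 (exp B)"
  have t: "t \<ge> 2" "t \<ge> exp B" by (simp_all add: t_def)
  have "B \<le> ln t" using t by (simp add: ln_ge_iff)
  moreover have "ln t / t\<^sup>2 \<le> 1"
  proof -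
    have "ln t \<le> t" using t ln_le_minus_one[of t] by simp
    also have "t \<le> t\<^sup>2" using t by (simp add: power2_eq_square)
    finally show ?thesis using t by simp
  qed
  ultimately have "B \<le> 1 * t - ell t" using ell_le_large[OF t(1)] by simp
  then have "ereal B \<le> ereal (1 * t - ell t)" by simp
  also have "\<dots> \<le> ell_star 1"
    unfolding ell_star_def using t by (intro SUP_upper) auto
  finally show "ereal B \<le> ell_star 1" .
qed

section \<open>Random variables of bounded oscillation\<close>

lemma (in prob_space) AE_imp_ex: "(AE x in M. P x) \<Longrightarrow> \<exists>x. P x"
  by (metis (mono_tags, lifting) AE_False eventually_mono)

text \<open>The endpoint \<open>b\<close> is the essential supremum of \<open>G\<close>: for almost
  every x, the number \<open>G x + T\<close> is an essential upper bound of \<open>G\<close> and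
  hence at least \<open>b\<close>.\<close>

lemma (in prob_space) obtain_interval_of_oscillation:
  fixes G :: "'a \<Rightarrow> real"
  assumes [measurable]: "G \<in> borel_measurable M"
    and osc: "AE x in M. AE y in M. \<bar>G x - G y\<bar> \<le> T"
  obtains b where "AE x in M. b - T \<le> G x \<and> G x \<le> b"
proof -
  define e where "e = esssup M (\<lambda>x. ereal (G x))"
  have le: "AE x in M. ereal (G x) \<le> e"
    unfolding e_def by (rule esssup_AE)
  have ge: "AE x in M. e \<le> ereal (G x + T)"
    using osc
  proof eventually_elim
    case (elim x)
    then have "AE y in M. ereal (G y) \<le> ereal (G x + T)"
      by eventually_elim auto
    then show ?case unfolding e_def by (intro esssup_I) auto
  qed
  from le ge have "AE x in M. \<bar>e\<bar> \<noteq> \<infinity>"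
    by eventually_elim auto
  then have "\<bar>e\<bar> \<noteq> \<infinity>" by simp
  then obtain b where b: "e = ereal b" by (cases e) auto
  have "AE x in M. b - T \<le> G x \<and> G x \<le> b"
    using le ge unfolding b by eventually_elim auto
  then show thesis by (rule that)
qed

lemma (in prob_space) integrable_of_oscillation:
  fixes G :: "'a \<Rightarrow> real"
  assumes [measurable]: "G \<in> borel_measurable M"
    and osc: "AE x in M. AE y in M. \<bar>G x - G y\<bar> \<le> T"
  shows "integrable M G"
    and "AE x in M. \<bar>G x - expectation G\<bar> \<le> T"
proof -
  obtain b where b: "AE x in M. b - T \<le> G x \<and> G x \<le> b"
    using obtain_interval_of_oscillation[OF assms] .
  then show G: "integrable M G"
    by (intro integrable_const_bound[where B = "\<bar>b\<bar> + \<bar>T\<bar>"]) auto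
  have "b - T \<le> expectation G" "expectation G \<le> b"
    using b by (auto intro!: integral_ge_const integral_le_const G)
  note m = this
  from b show "AE x in M. \<bar>G x - expectation G\<bar> \<le> T"
    by eventually_elim (use m in auto)
qed

text \<open>A form of Hoeffding's lemma. On an interval of length \<open>T\<close> containing the
  values of \<open>G\<close>, exp lies below its chord. The mean of the chord depends on
  \<open>G\<close> only through its mean, so it is that of the two-point variable on the endpoints
  with the same mean, which puts weight \<open>p\<close> on the upper one.\<close>

lemma (in prob_space) mgf_le_of_oscillation:
  fixes G :: "'a \<Rightarrow> real"
  assumes [measurable]: "G \<in> borel_measurable M"
    and osc: "AE x in M. AE y in M. \<bar>G x - G y\<bar> \<le> T"
    and "T > 0" "t \<ge> 0"
  shows "(\<integral>\<^sup>+x. ennreal (exp (t * (G x - expectation G))) \<partial>M) \<le> ennreal (exp (ell (T * t)))"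
proof -
  obtain b where b: "AE x in M. b - T \<le> G x \<and> G x \<le> b"
    using obtain_interval_of_oscillation[OF assms(1,2)] .
  have G: "integrable M G" using integrable_of_oscillation[OF assms(1,2)] by simp
  define m where "m = expectation G"
  define p where "p = (m - (b - T)) / T"
  have "b - T \<le> m" "m \<le> b"
    unfolding m_def using b by (auto intro!: integral_ge_const integral_le_const G)
  then have p: "0 \<le> p" "p \<le> 1" using \<open>T > 0\<close> by (auto simp: p_def field_simps)
  have m_eq: "m = b - T + p * T" using \<open>T > 0\<close> by (simp add: p_def)
  define q where "q = (\<lambda>x. (G x - (b - T)) / T)"
  have q: "expectation q = p" "integrable M q"
    using G by (simp_all add: q_def p_def m_def prob_space)
  have chord: "AE x in M. exp (t * (G x - m)) \<le> exp (- p * (T * t)) * ((1 - q x) + q x * exp (T * t))"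
    using b
  proof eventually_elim
    case (elim x)
    then have "0 \<le> q x" "q x \<le> 1" using \<open>T > 0\<close> by (auto simp: q_def field_simps)
    then have "exp (t * ((1 - q x) *\<^sub>R 0 + q x *\<^sub>R T)) \<le> (1 - q x) * exp (t * 0) + q x * exp (t * T)"
      by (intro convex_onD[OF convex_on_exp]) (use \<open>t \<ge> 0\<close> in auto)
    then have "exp (- p * (T * t)) * exp (t * (q x * T)) \<le> exp (- p * (T * t)) * ((1 - q x) + q x * exp (T * t))"
      by (simp add: mult_ac)
    moreover have "exp (t * (G x - m)) = exp (- p * (T * t)) * exp (t * (q x * T))"
    proof -
      have qT: "q x * T = G x - (b - T)" using \<open>T > 0\<close> by (simp add: q_def)
      show ?thesis unfolding qT m_eq exp_add[symmetric] by (simp add: algebra_simps)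
    qed
    ultimately show ?case by simp
  qed
  have "(\<integral>\<^sup>+x. ennreal (exp (t * (G x - m))) \<partial>M)
      \<le> (\<integral>\<^sup>+x. ennreal (exp (- p * (T * t)) * ((1 - q x) + q x * exp (T * t))) \<partial>M)"
    using chord by (intro nn_integral_mono_AE) (auto elim!: eventually_mono intro!: ennreal_leI)
  also have "\<dots> = ennreal (\<integral>x. exp (- p * (T * t)) * ((1 - q x) + q x * exp (T * t)) \<partial>M)"
  proof (rule nn_integral_eq_integral)
    show "integrable M (\<lambda>x. exp (- p * (T * t)) * ((1 - q x) + q x * exp (T * t)))"
      using q(2) by simp
    show "AE x in M. 0 \<le> exp (- p * (T * t)) * ((1 - q x) + q x * exp (T * t))"
      using chord by eventually_elim (rule order_trans[OF exp_ge_zero])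
  qed
  also have "(\<integral>x. exp (- p * (T * t)) * ((1 - q x) + q x * exp (T * t)) \<partial>M)
      = exp (- p * (T * t)) * (1 - p + p * exp (T * t))"
    using q by (simp add: prob_space)
  also have "\<dots> = exp (ln (1 - p + p * exp (T * t)) - p * (T * t))"
  proof -
    have "p * exp (T * t) \<ge> p * 1" using p \<open>T > 0\<close> \<open>t \<ge> 0\<close> by (intro mult_left_mono) auto
    moreover have "p * exp (T * t) > 0 \<or> p = 0" using p by auto
    ultimately have "1 - p + p * exp (T * t) > 0" using p by auto
    then show ?thesis by (simp add: exp_diff exp_minus field_simps)
  qed
  also have "\<dots> \<le> exp (ell (T * t))"
    using ln_bernoulli_mgf_le_ell[of p "T * t"] p \<open>T > 0\<close> \<open>t \<ge> 0\<close> by simp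
  finally show ?thesis by (simp add: m_def ennreal_leI)
qed

text \<open>The product form makes Fubini available for functions of a history, the next innovation
  and its copy.\<close>

lemma (in prob_space) distr_Pair_of_indep_var:
  assumes indep: "indep_var A U B V"
    and [measurable]: "\<phi> \<in> measurable A S" "\<psi> \<in> measurable B T"
  shows "distr M (S \<Otimes>\<^sub>M T) (\<lambda>\<omega>. (\<phi> (U \<omega>), \<psi> (V \<omega>))) =
    distr M S (\<lambda>\<omega>. \<phi> (U \<omega>)) \<Otimes>\<^sub>M distr M T (\<lambda>\<omega>. \<psi> (V \<omega>))"
proof -
  note [measurable] = indep_var_rv1[OF indep] indep_var_rv2[OF indep]
  interpret T: prob_space "distr M T (\<lambda>\<omega>. \<psi> (V \<omega>))" by (intro prob_space_distr) measurable
  have S: "distr M S (\<lambda>\<omega>. \<phi> (U \<omega>)) = distr (distr M A U) S \<phi>"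
    and T: "distr M T (\<lambda>\<omega>. \<psi> (V \<omega>)) = distr (distr M B V) T \<psi>"
    by (simp_all add: distr_distr comp_def)
  have "distr M S (\<lambda>\<omega>. \<phi> (U \<omega>)) \<Otimes>\<^sub>M distr M T (\<lambda>\<omega>. \<psi> (V \<omega>))
      = distr (distr M A U \<Otimes>\<^sub>M distr M B V) (S \<Otimes>\<^sub>M T) (\<lambda>(x, y). (\<phi> x, \<psi> y))"
    unfolding S T using T.sigma_finite_measure_axioms
    by (intro pair_measure_distr) (simp_all add: T)
  also have "\<dots> = distr M (S \<Otimes>\<^sub>M T) (\<lambda>\<omega>. (\<phi> (U \<omega>), \<psi> (V \<omega>)))"
    using indep unfolding indep_var_distribution_eq by (simp add: distr_distr comp_def)
  finally show ?thesis by simp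
qed

section \<open>The martingale of the iterated random function\<close>

text \<open>Entry \<open>j\<close> of \<open>hist past F e k\<close> is \<open>X\<^sub>k\<^sub>-\<^sub>j\<close>, so that the head is the latest state.\<close>

primrec hist :: "(int \<Rightarrow> 'x) \<Rightarrow> (nat \<Rightarrow> (nat \<Rightarrow> 'x) \<Rightarrow> 'y \<Rightarrow> 'x) \<Rightarrow> (nat \<Rightarrow> 'y) \<Rightarrow> nat \<Rightarrow> nat \<Rightarrow> 'x" where
  "hist past F e 0 = (\<lambda>j. past (- int j))"
| "hist past F e (Suc k) = case_nat (F (Suc k) (hist past F e k) (e (Suc k))) (hist past F e k)"

lemma hist_cong:
  assumes "\<And>i. i \<in> {1..k} \<Longrightarrow> e i = e' i"
  shows "hist past F e k = hist past F e' k"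
  using assms by (induction k) auto

text \<open>The Lipschitz constant, in the state \<open>j\<close> steps back, of the conditional expectation of \<open>f\<close> when
  \<open>m\<close> steps remain.\<close>

definition lip :: "(nat \<Rightarrow> real) \<Rightarrow> nat \<Rightarrow> nat \<Rightarrow> real" where
  "lip a m j = 1 + (\<Sum>l<m. a_diag a l * a (m - l + j))"

lemma lip_0: "lip a 0 j = 1"
  by (simp add: lip_def)

text \<open>One more remaining step shifts every older state back by one; the contraction trades the
  averaged new state, of constant \<open>a_diag a m\<close>, for older states with weights
  \<open>a (Suc j)\<close>.\<close>

lemma lip_Suc: "lip a (Suc m) j = lip a m (Suc j) + a_diag a m * a (Suc j)"
  by (simp add: lip_def Suc_diff_le)

lemma lip_diag: "lip a m 0 = a_diag a m"
proof (cases m)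
  case (Suc k)
  \<comment> \<open>The index 0 is split off because it supplies the term \<open>a (Suc k)\<close>
    of the recursion, as \<open>a_diag a 0 = 1\<close>.\<close>
  have "{..<Suc k} = insert 0 {1..k}" by auto
  then show ?thesis by (simp add: lip_def Suc)
qed (simp add: lip_def)

lemma a_diag_ge_1:
  assumes "\<And>i. i \<ge> 1 \<Longrightarrow> a i \<ge> 0"
  shows "a_diag a k \<ge> 1"
proof (induction k rule: less_induct)
  case (less k)
  show ?case
  proof (cases k)
    case (Suc j)
    have "a_diag a l * a (Suc j - l) \<ge> 0" if "l \<in> {1..j}" for l
      using less[of l] that assms[of "Suc j - l"] Suc by (intro mult_nonneg_nonneg) auto
    then have "(\<Sum>l=1..j. a_diag a l * a (Suc j - l)) \<ge> 0" by (rule sum_nonneg)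
    then show ?thesis using Suc assms[of "Suc j"] by simp
  qed simp
qed

lemma lip_nonneg:
  assumes "\<And>i. i \<ge> 1 \<Longrightarrow> a i \<ge> 0"
  shows "lip a m j \<ge> 0"
  unfolding lip_def using a_diag_ge_1[OF assms] assms
  by (intro add_nonneg_nonneg sum_nonneg mult_nonneg_nonneg) (auto intro: order_trans[OF zero_le_one])

text \<open>A locale with \<open>f\<close> as a parameter lets the argument be instantiated at f and
  at -f.\<close>

locale random_iteration = prob_space M
  for M :: "'w measure" +
  fixes \<epsilon> \<epsilon>' :: "nat \<Rightarrow> 'w \<Rightarrow> 'y::polish_space"
    and X :: "int \<Rightarrow> 'w \<Rightarrow> 'x::polish_space"
    and past :: "int \<Rightarrow> 'x"
    and F :: "nat \<Rightarrow> (nat \<Rightarrow> 'x) \<Rightarrow> 'y \<Rightarrow> 'x"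
    and a :: "nat \<Rightarrow> real"
    and n :: nat
    and f :: "(nat \<Rightarrow> 'x) \<Rightarrow> real"
    and Mb :: "nat \<Rightarrow> real"
  assumes indep: "indep_vars (\<lambda>_. borel) \<epsilon> {1..}"
    and F_meas: "\<And>m. m \<ge> 1 \<Longrightarrow> (\<lambda>(s, y). F m s y) \<in> measurable ((\<Pi>\<^sub>M j\<in>UNIV. borel) \<Otimes>\<^sub>M borel) borel"
    and X_past: "\<And>i \<omega>. i \<le> 0 \<Longrightarrow> \<omega> \<in> space M \<Longrightarrow> X i \<omega> = past i"
    and X_rec: "\<And>m \<omega>. m \<ge> 1 \<Longrightarrow> \<omega> \<in> space M \<Longrightarrow>
          X (int m) \<omega> = F m (preceding (\<lambda>i. X i \<omega>) m) (\<epsilon> m \<omega>)"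
    and a_nonneg: "\<And>i. i \<ge> 1 \<Longrightarrow> a i \<ge> 0"
    and contraction: "\<And>m s s'. m \<ge> 1 \<Longrightarrow>
          (\<integral>\<^sup>+\<omega>. ennreal (dist (F m s (\<epsilon> m \<omega>)) (F m s' (\<epsilon> m \<omega>))) \<partial>M)
            \<le> (\<Sum>j. ennreal (a (Suc j) * dist (s j) (s' j)))"
    and f_lip: "\<And>x x'. x \<in> {1..n} \<rightarrow>\<^sub>E UNIV \<Longrightarrow> x' \<in> {1..n} \<rightarrow>\<^sub>E UNIV \<Longrightarrow>
          \<bar>f x - f x'\<bar> \<le> (\<Sum>i=1..n. dist (x i) (x' i))"
    and copy: "indep_copy {1..} borel \<epsilon> \<epsilon>'"
    and Mb_pos: "\<And>k. k \<in> {1..n} \<Longrightarrow> Mb k > 0"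
    and Mb_bound: "\<And>k. k \<in> {1..n} \<Longrightarrow>
          esssup M (\<lambda>\<omega>. ennreal (dist (F k (preceding (\<lambda>i. X i \<omega>) k) (\<epsilon> k \<omega>))
                                       (F k (preceding (\<lambda>i. X i \<omega>) k) (\<epsilon>' k \<omega>)))) \<le> ennreal (Mb k)"
begin

abbreviation histories :: "(nat \<Rightarrow> 'x) measure" where
  "histories \<equiv> \<Pi>\<^sub>M j\<in>UNIV. borel"

definition law :: "nat \<Rightarrow> 'y measure" where
  "law k = distr M borel (\<epsilon> k)"

text \<open>The process is written as a function of the innovations alone, so that their
  independence applies; \<open>H_eq_X\<close> identifies it with \<open>X\<close>.\<close>

definition H :: "nat \<Rightarrow> 'w \<Rightarrow> nat \<Rightarrow> 'x" where
  "H k \<omega> = hist past F (\<lambda>i. \<epsilon> i \<omega>) k"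

text \<open>Two histories with this property for the same \<open>k\<close> can differ only in their
  first \<open>k\<close> entries, which turns the series of the contraction assumption into a finite
  sum.\<close>

definition shares_past :: "nat \<Rightarrow> (nat \<Rightarrow> 'x) \<Rightarrow> bool" where
  "shares_past k s \<longleftrightarrow> (\<forall>j\<ge>k. s j = past (int k - int j))"

text \<open>The argument \<open>m\<close> is the number of remaining steps: the history \<open>s\<close> is that of time \<open>n - m\<close>.\<close>

primrec cond_mean :: "nat \<Rightarrow> (nat \<Rightarrow> 'x) \<Rightarrow> real" where
  "cond_mean 0 s = f (\<lambda>i\<in>{1..n}. s (n - i))"
| "cond_mean (Suc m) s = (\<integral>y. cond_mean m (case_nat (F (n - m) s y) s) \<partial>law (n - m))"

lemma \<epsilon>_measurable [measurable]: "k \<ge> 1 \<Longrightarrow> \<epsilon> k \<in> borel_measurable M"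
  using indep by (auto simp: indep_vars_def)

lemma prob_space_law: "k \<ge> 1 \<Longrightarrow> prob_space (law k)"
  unfolding law_def by (intro prob_space_distr) simp

lemma sets_law [measurable_cong, simp]: "sets (law k) = sets borel"
  by (simp add: law_def)

lemma F_measurable [measurable (raw)]:
  assumes "m \<ge> 1" "g \<in> measurable N histories" "h \<in> borel_measurable N"
  shows "(\<lambda>x. F m (g x) (h x)) \<in> borel_measurable N"
  using measurable_compose[OF measurable_Pair[OF assms(2,3)] F_meas[OF assms(1)]] by simp

text \<open>The index set is left open: it is \<open>{1..k}\<close> when the history is separated
  from the next innovation, and \<open>{1..}\<close> when the whole family is compared with its
  copy.\<close>

lemma hist_measurable:
  assumes "{1..k} \<subseteq> I"
  shows "(\<lambda>e. hist past F e k) \<in> measurable (\<Pi>\<^sub>M i\<in>I. borel) histories"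
  using assms
proof (induction k)
  case (Suc k)
  have "(\<lambda>e. hist past F e k) \<in> measurable (\<Pi>\<^sub>M i\<in>I. borel) histories"
    using Suc.prems by (intro Suc.IH) auto
  moreover have "(\<lambda>e. e (Suc k)) \<in> measurable (\<Pi>\<^sub>M i\<in>I. borel :: 'y measure) borel"
    using Suc.prems by (intro measurable_component_singleton) auto
  ultimately show ?case
    unfolding hist.simps by (intro measurable_case_nat' F_measurable) auto
qed (simp add: measurable_const space_PiM)

lemma H_eq_restrict: "{1..k} \<subseteq> I \<Longrightarrow> H k \<omega> = hist past F (\<lambda>i\<in>I. \<epsilon> i \<omega>) k"
  unfolding H_def by (intro hist_cong) auto

lemma H_Suc: "H (Suc k) \<omega> = case_nat (F (Suc k) (H k \<omega>) (\<epsilon> (Suc k) \<omega>)) (H k \<omega>)"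
  by (simp add: H_def)

lemma H_measurable [measurable]: "H k \<in> measurable M histories"
proof (induction k)
  case 0
  have "H 0 = (\<lambda>\<omega> j. past (- int j))" by (auto simp: H_def)
  then show ?case by (simp add: measurable_const space_PiM)
next
  case (Suc k)
  note [measurable] = Suc
  have "H (Suc k) = (\<lambda>\<omega>. case_nat (F (Suc k) (H k \<omega>) (\<epsilon> (Suc k) \<omega>)) (H k \<omega>))"
    by (rule ext, rule H_Suc)
  then show ?case by simp
qed

lemma H_eq_X:
  assumes "\<omega> \<in> space M"
  shows "H k \<omega> = (\<lambda>j. X (int k - int j) \<omega>)"
proof (induction k)
  case 0
  show ?case using X_past assms by (auto simp: H_def)
next
  case (Suc k)
  have "preceding (\<lambda>i. X i \<omega>) (Suc k) = H k \<omega>"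
    unfolding Suc preceding_def by simp
  then have "X (int (Suc k)) \<omega> = F (Suc k) (H k \<omega>) (\<epsilon> (Suc k) \<omega>)"
    using X_rec[of "Suc k" \<omega>] assms by simp
  then show ?case
    unfolding H_Suc by (auto simp: fun_eq_iff Suc split: nat.splits)
qed

lemma preceding_eq_H:
  assumes "\<omega> \<in> space M"
  shows "preceding (\<lambda>i. X i \<omega>) (Suc k) = H k \<omega>"
  unfolding H_eq_X[OF assms] preceding_def by simp

lemma shares_past_H: "shares_past k (H k \<omega>)"
proof (induction k)
  case 0
  show ?case by (simp add: shares_past_def H_def)
next
  case (Suc k)
  then show ?case by (auto simp: shares_past_def H_Suc split: nat.splits)
qed

lemma shares_past_Suc: "shares_past k s \<Longrightarrow> shares_past (Suc k) (case_nat x s)"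
  by (auto simp: shares_past_def split: nat.splits)

section \<open>Product laws of history, innovation and independent copy\<close>

lemma joint_law: "distr M (histories \<Otimes>\<^sub>M borel) (\<lambda>\<omega>. (H k \<omega>, \<epsilon> (Suc k) \<omega>)) = distr M histories (H k) \<Otimes>\<^sub>M law (Suc k)"
proof -
  \<comment> \<open>The history at time \<open>k\<close> is a function of the innovations indexed by
    \<open>{1..k}\<close>, a set disjoint from \<open>{Suc k}\<close>.\<close>
  have "indep_var (\<Pi>\<^sub>M i\<in>{1..k}. borel) (\<lambda>\<omega>. \<lambda>i\<in>{1..k}. \<epsilon> i \<omega>) (\<Pi>\<^sub>M i\<in>{Suc k}. borel) (\<lambda>\<omega>. \<lambda>i\<in>{Suc k}. \<epsilon> i \<omega>)"
    by (rule indep_var_restrict[OF indep]) auto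
  from distr_Pair_of_indep_var[OF this, of "\<lambda>e. hist past F e k" histories "\<lambda>e. e (Suc k)" borel]
  have "distr M (histories \<Otimes>\<^sub>M borel) (\<lambda>\<omega>. (hist past F (\<lambda>i\<in>{1..k}. \<epsilon> i \<omega>) k, \<epsilon> (Suc k) \<omega>))
      = distr M histories (\<lambda>\<omega>. hist past F (\<lambda>i\<in>{1..k}. \<epsilon> i \<omega>) k) \<Otimes>\<^sub>M distr M borel (\<epsilon> (Suc k))"
    using hist_measurable[of k "{1..k}"] by (simp add: measurable_component_singleton)
  moreover have "H k = (\<lambda>\<omega>. hist past F (\<lambda>i\<in>{1..k}. \<epsilon> i \<omega>) k)"
    by (intro ext H_eq_restrict) auto
  ultimately show ?thesis
    unfolding law_def by simp
qed

lemma copy_measurable: "k \<ge> 1 \<Longrightarrow> \<epsilon>' k \<in> borel_measurable M"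
  and law_copy: "k \<ge> 1 \<Longrightarrow> distr M borel (\<epsilon>' k) = law k"
proof -
  assume k: "k \<ge> 1"
  have I: "indep_var (\<Pi>\<^sub>M i\<in>{1..}. borel) (\<lambda>\<omega>. \<lambda>i\<in>{1..}. \<epsilon> i \<omega>) (\<Pi>\<^sub>M i\<in>{1..}. borel) (\<lambda>\<omega>. \<lambda>i\<in>{1..}. \<epsilon>' i \<omega>)"
    and eq: "distr M (\<Pi>\<^sub>M i\<in>{1..}. borel) (\<lambda>\<omega>. \<lambda>i\<in>{1..}. \<epsilon>' i \<omega>) = distr M (\<Pi>\<^sub>M i\<in>{1..}. borel) (\<lambda>\<omega>. \<lambda>i\<in>{1..}. \<epsilon> i \<omega>)"
    using copy by (simp_all add: indep_copy_def)
  have c: "(\<lambda>e. e k) \<in> measurable (\<Pi>\<^sub>M i\<in>{1..}. borel :: 'y measure) borel"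
    using k by (intro measurable_component_singleton) auto
  note m = indep_var_rv1[OF I] indep_var_rv2[OF I]
  have "(\<lambda>\<omega>. (\<lambda>i\<in>{1..}. \<epsilon>' i \<omega>) k) \<in> borel_measurable M"
    using m(2) c by (rule measurable_compose)
  then show "\<epsilon>' k \<in> borel_measurable M" using k by simp
  have "distr M borel (\<epsilon>' k) = distr (distr M (\<Pi>\<^sub>M i\<in>{1..}. borel) (\<lambda>\<omega>. \<lambda>i\<in>{1..}. \<epsilon>' i \<omega>)) borel (\<lambda>e. e k)"
    using k by (subst distr_distr[OF c m(2)]) (simp add: comp_def)
  also have "\<dots> = law k"
    unfolding eq using k by (subst distr_distr[OF c m(1)]) (simp add: comp_def law_def)
  finally show "distr M borel (\<epsilon>' k) = law k" .
qed

text \<open>The pair of history and innovation is a function of the family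
  \<open>\<epsilon>\<close>, which is independent of \<open>\<epsilon>'\<close>;
  \<open>joint_law\<close> then splits that pair as well.\<close>

lemma joint_law_copy:
  "distr M ((histories \<Otimes>\<^sub>M borel) \<Otimes>\<^sub>M borel) (\<lambda>\<omega>. ((H k \<omega>, \<epsilon> (Suc k) \<omega>), \<epsilon>' (Suc k) \<omega>)) =
    (distr M histories (H k) \<Otimes>\<^sub>M law (Suc k)) \<Otimes>\<^sub>M law (Suc k)"
proof -
  have I: "indep_var (\<Pi>\<^sub>M i\<in>{1..}. borel) (\<lambda>\<omega>. \<lambda>i\<in>{1..}. \<epsilon> i \<omega>) (\<Pi>\<^sub>M i\<in>{1..}. borel) (\<lambda>\<omega>. \<lambda>i\<in>{1..}. \<epsilon>' i \<omega>)"
    using copy by (simp add: indep_copy_def)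
  have c: "(\<lambda>e. e (Suc k)) \<in> measurable (\<Pi>\<^sub>M i\<in>{1..}. borel :: 'y measure) borel"
    by (intro measurable_component_singleton) auto
  moreover have "(\<lambda>e. hist past F e k) \<in> measurable (\<Pi>\<^sub>M i\<in>{1..}. borel) histories"
    by (intro hist_measurable) auto
  ultimately have hc: "(\<lambda>e. (hist past F e k, e (Suc k))) \<in> measurable (\<Pi>\<^sub>M i\<in>{1..}. borel) (histories \<Otimes>\<^sub>M borel)"
    by (rule measurable_Pair[rotated])
  from distr_Pair_of_indep_var[OF I hc c]
  have "distr M ((histories \<Otimes>\<^sub>M borel) \<Otimes>\<^sub>M borel) (\<lambda>\<omega>. ((hist past F (\<lambda>i\<in>{1..}. \<epsilon> i \<omega>) k, \<epsilon> (Suc k) \<omega>), \<epsilon>' (Suc k) \<omega>))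
      = distr M (histories \<Otimes>\<^sub>M borel) (\<lambda>\<omega>. (hist past F (\<lambda>i\<in>{1..}. \<epsilon> i \<omega>) k, \<epsilon> (Suc k) \<omega>)) \<Otimes>\<^sub>M distr M borel (\<epsilon>' (Suc k))"
    by simp
  moreover have "H k = (\<lambda>\<omega>. hist past F (\<lambda>i\<in>{1..}. \<epsilon> i \<omega>) k)"
    by (intro ext H_eq_restrict) auto
  ultimately show ?thesis unfolding joint_law[symmetric] by (simp add: law_copy)
qed

lemma nn_integral_step:
  assumes [measurable]: "g \<in> borel_measurable (histories \<Otimes>\<^sub>M borel)"
  shows "(\<integral>\<^sup>+\<omega>. g (H k \<omega>, \<epsilon> (Suc k) \<omega>) \<partial>M) = (\<integral>\<^sup>+\<omega>. \<integral>\<^sup>+y. g (H k \<omega>, y) \<partial>law (Suc k) \<partial>M)"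
proof -
  interpret L: prob_space "law (Suc k)" by (rule prob_space_law) simp
  have "(\<integral>\<^sup>+\<omega>. g (H k \<omega>, \<epsilon> (Suc k) \<omega>) \<partial>M) = (\<integral>\<^sup>+z. g z \<partial>distr M (histories \<Otimes>\<^sub>M borel) (\<lambda>\<omega>. (H k \<omega>, \<epsilon> (Suc k) \<omega>)))"
    by (subst nn_integral_distr) auto
  also have "\<dots> = (\<integral>\<^sup>+h. \<integral>\<^sup>+y. g (h, y) \<partial>law (Suc k) \<partial>distr M histories (H k))"
    unfolding joint_law by (subst L.nn_integral_fst[symmetric]) auto
  also have "\<dots> = (\<integral>\<^sup>+\<omega>. \<integral>\<^sup>+y. g (H k \<omega>, y) \<partial>law (Suc k) \<partial>M)"
    by (subst nn_integral_distr) auto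
  finally show ?thesis .
qed

lemma integral_step:
  fixes g :: "(nat \<Rightarrow> 'x) \<times> 'y \<Rightarrow> real"
  assumes [measurable]: "g \<in> borel_measurable (histories \<Otimes>\<^sub>M borel)"
    and int: "integrable M (\<lambda>\<omega>. g (H k \<omega>, \<epsilon> (Suc k) \<omega>))"
  shows "(\<integral>\<omega>. g (H k \<omega>, \<epsilon> (Suc k) \<omega>) \<partial>M) = (\<integral>\<omega>. \<integral>y. g (H k \<omega>, y) \<partial>law (Suc k) \<partial>M)"
proof -
  interpret L: prob_space "law (Suc k)" by (rule prob_space_law) simp
  interpret HL: prob_space "distr M histories (H k)" by (rule prob_space_distr) simp
  interpret P: pair_sigma_finite "distr M histories (H k)" "law (Suc k)" ..
  have "integrable (distr M (histories \<Otimes>\<^sub>M borel) (\<lambda>\<omega>. (H k \<omega>, \<epsilon> (Suc k) \<omega>))) g"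
    using int by (subst integrable_distr_eq) auto
  then have i: "integrable (distr M histories (H k) \<Otimes>\<^sub>M law (Suc k)) g"
    unfolding joint_law .
  have "(\<integral>\<omega>. g (H k \<omega>, \<epsilon> (Suc k) \<omega>) \<partial>M) = (\<integral>z. g z \<partial>distr M (histories \<Otimes>\<^sub>M borel) (\<lambda>\<omega>. (H k \<omega>, \<epsilon> (Suc k) \<omega>)))"
    by (subst integral_distr) auto
  also have "\<dots> = (\<integral>h. \<integral>y. g (h, y) \<partial>law (Suc k) \<partial>distr M histories (H k))"
    unfolding joint_law using P.integral_fst'[OF i] by simp
  also have "\<dots> = (\<integral>\<omega>. \<integral>y. g (H k \<omega>, y) \<partial>law (Suc k) \<partial>M)"
    by (subst integral_distr) auto
  finally show ?thesis .
qed

text \<open>The essential supremum bound concerns \<open>H k\<close>,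
  \<open>\<epsilon> (Suc k)\<close> and \<open>\<epsilon>' (Suc k)\<close> jointly. Their law is a
  product in which the innovation law occurs twice, so Fubini resolves the bound into nested almost
  sure statements.\<close>

lemma AE_step_oscillation:
  assumes "Suc k \<le> n"
  shows "AE \<omega> in M. AE y in law (Suc k). AE y' in law (Suc k).
    dist (F (Suc k) (H k \<omega>) y) (F (Suc k) (H k \<omega>) y') \<le> Mb (Suc k)"
proof -
  interpret L: prob_space "law (Suc k)" by (rule prob_space_law) simp
  interpret HL: prob_space "distr M histories (H k)" by (rule prob_space_distr) simp
  interpret P: pair_prob_space "distr M histories (H k)" "law (Suc k)" ..
  interpret P2: pair_prob_space "distr M histories (H k) \<Otimes>\<^sub>M law (Suc k)" "law (Suc k)" ..
  note [measurable] = copy_measurable[of "Suc k", simplified]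
  define d where "d = (\<lambda>z::((nat \<Rightarrow> 'x) \<times> 'y) \<times> 'y.
    dist (F (Suc k) (fst (fst z)) (snd (fst z))) (F (Suc k) (fst (fst z)) (snd z)))"
  have [measurable]: "d \<in> borel_measurable ((histories \<Otimes>\<^sub>M borel) \<Otimes>\<^sub>M borel)"
    unfolding d_def by measurable
  have "AE \<omega> in M. ennreal (dist (F (Suc k) (preceding (\<lambda>i. X i \<omega>) (Suc k)) (\<epsilon> (Suc k) \<omega>))
      (F (Suc k) (preceding (\<lambda>i. X i \<omega>) (Suc k)) (\<epsilon>' (Suc k) \<omega>))) \<le> ennreal (Mb (Suc k))"
    using Mb_bound[of "Suc k"] assms
    by (intro eventually_mono[OF esssup_AE]) (auto intro: order_trans)
  then have "AE \<omega> in M. d ((H k \<omega>, \<epsilon> (Suc k) \<omega>), \<epsilon>' (Suc k) \<omega>) \<le> Mb (Suc k)"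
    using AE_space
  proof eventually_elim
    case (elim \<omega>)
    then show ?case
      using Mb_pos[of "Suc k"] assms by (simp add: d_def preceding_eq_H)
  qed
  then have "AE z in distr M ((histories \<Otimes>\<^sub>M borel) \<Otimes>\<^sub>M borel) (\<lambda>\<omega>. ((H k \<omega>, \<epsilon> (Suc k) \<omega>), \<epsilon>' (Suc k) \<omega>)). d z \<le> Mb (Suc k)"
    by (subst AE_distr_iff) auto
  then have "AE h in distr M histories (H k). AE y in law (Suc k). AE y' in law (Suc k). d ((h, y), y') \<le> Mb (Suc k)"
    unfolding joint_law_copy by (intro P.AE_pair P2.AE_pair)
  then have "AE \<omega> in M. AE y in law (Suc k). AE y' in law (Suc k). d ((H k \<omega>, y), y') \<le> Mb (Suc k)"
    by (rule AE_distrD[rotated]) simp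
  then show ?thesis by (simp add: d_def)
qed

text \<open>The Lipschitz property of \<open>f\<close> makes this function continuous for the
  product topology, and in Polish spaces the Borel sets of a countable product generate the same
  sigma-algebra as the coordinates.\<close>

lemma cond_mean_0_measurable: "cond_mean 0 \<in> borel_measurable histories"
proof -
  have "isCont (cond_mean 0) s" for s
    unfolding isCont_def
  proof (subst tendsto_dist_iff, rule Lim_null_comparison)
    show "\<forall>\<^sub>F s' in at s. norm (dist (cond_mean 0 s') (cond_mean 0 s)) \<le> (\<Sum>i=1..n. dist (s' (n - i)) (s (n - i)))"
    proof (rule always_eventually, rule allI)
      fix s' :: "nat \<Rightarrow> 'x"
      have "dist (cond_mean 0 s') (cond_mean 0 s) \<le> (\<Sum>i=1..n. dist ((\<lambda>i\<in>{1..n}. s' (n - i)) i) ((\<lambda>i\<in>{1..n}. s (n - i)) i))"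
        unfolding cond_mean.simps dist_real_def by (rule f_lip) auto
      then show "norm (dist (cond_mean 0 s') (cond_mean 0 s)) \<le> (\<Sum>i=1..n. dist (s' (n - i)) (s (n - i)))"
        by simp
    qed
    have "((\<lambda>s'. s' j) \<longlongrightarrow> s j) (at s)" for j
      using continuous_on_product_coordinates[where 'b = 'x, of j]
      unfolding continuous_on_eq_continuous_at[OF open_UNIV] isCont_def by blast
    then have "((\<lambda>s'. \<Sum>i=1..n. dist (s' (n - i)) (s (n - i))) \<longlongrightarrow> (\<Sum>i=1..n. dist (s (n - i)) (s (n - i)))) (at s)"
      by (intro tendsto_intros)
    then show "((\<lambda>s'. \<Sum>i=1..n. dist (s' (n - i)) (s (n - i))) \<longlongrightarrow> 0) (at s)"
      by simp
  qed
  then have "cond_mean 0 \<in> borel_measurable borel"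
    by (intro borel_measurable_continuous_onI continuous_at_imp_continuous_on) auto
  then show ?thesis
    using measurable_cong_sets[OF sets_PiM_equal_borel refl] by blast
qed

lemma cond_mean_measurable [measurable]: "m \<le> n \<Longrightarrow> cond_mean m \<in> borel_measurable histories"
proof (induction m)
  case 0
  show ?case by (rule cond_mean_0_measurable)
next
  case (Suc m)
  then have [measurable]: "cond_mean m \<in> borel_measurable histories" and m: "n - m \<ge> 1" by auto
  interpret L: prob_space "law (n - m)" by (rule prob_space_law) (use m in simp)
  have "(\<lambda>s. \<integral>y. cond_mean m (case_nat (F (n - m) s y) s) \<partial>law (n - m)) \<in> borel_measurable histories"
    using m by measurable
  moreover have "cond_mean (Suc m) = (\<lambda>s. \<integral>y. cond_mean m (case_nat (F (n - m) s y) s) \<partial>law (n - m))"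
    by (rule ext) simp
  ultimately show ?case by simp
qed

section \<open>Lipschitz bounds for the conditional means\<close>

lemma contraction_law:
  assumes "shares_past k s" "shares_past k s'"
  shows "integrable (law (Suc k)) (\<lambda>y. dist (F (Suc k) s y) (F (Suc k) s' y))"
    and "(\<integral>y. dist (F (Suc k) s y) (F (Suc k) s' y) \<partial>law (Suc k)) \<le> (\<Sum>j<k. a (Suc j) * dist (s j) (s' j))"
proof -
  have [measurable]: "(\<lambda>y. F (Suc k) u y) \<in> borel_measurable borel" for u
    by (intro F_measurable) (auto simp: measurable_const space_PiM)
  have nonneg: "(\<Sum>j<k. a (Suc j) * dist (s j) (s' j)) \<ge> 0"
    using a_nonneg by (intro sum_nonneg) auto
  have "(\<integral>\<^sup>+y. ennreal (dist (F (Suc k) s y) (F (Suc k) s' y)) \<partial>law (Suc k))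
      = (\<integral>\<^sup>+\<omega>. ennreal (dist (F (Suc k) s (\<epsilon> (Suc k) \<omega>)) (F (Suc k) s' (\<epsilon> (Suc k) \<omega>))) \<partial>M)"
    unfolding law_def by (subst nn_integral_distr) auto
  also have "\<dots> \<le> (\<Sum>j. ennreal (a (Suc j) * dist (s j) (s' j)))"
    by (rule contraction) simp
  also have "\<dots> = (\<Sum>j<k. ennreal (a (Suc j) * dist (s j) (s' j)))"
    using assms by (intro suminf_finite) (auto simp: shares_past_def)
  also have "\<dots> = ennreal (\<Sum>j<k. a (Suc j) * dist (s j) (s' j))"
    using a_nonneg by (intro sum_ennreal) auto
  finally have le: "(\<integral>\<^sup>+y. ennreal (dist (F (Suc k) s y) (F (Suc k) s' y)) \<partial>law (Suc k))
      \<le> ennreal (\<Sum>j<k. a (Suc j) * dist (s j) (s' j))" .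
  show int: "integrable (law (Suc k)) (\<lambda>y. dist (F (Suc k) s y) (F (Suc k) s' y))"
    using le_less_trans[OF le ennreal_less_top] by (intro integrableI_bounded) auto
  show "(\<integral>y. dist (F (Suc k) s y) (F (Suc k) s' y) \<partial>law (Suc k)) \<le> (\<Sum>j<k. a (Suc j) * dist (s j) (s' j))"
    using le nonneg by (subst (asm) nn_integral_eq_integral[OF int]) auto
qed

text \<open>Bounded oscillation holds only along the histories of the process itself; the contraction
  assumption carries integrability over to all histories with the same remote past.\<close>

lemma integrable_dist_point:
  assumes "Suc k \<le> n" "shares_past k s"
  shows "\<exists>x0. integrable (law (Suc k)) (\<lambda>y. dist (F (Suc k) s y) x0)"
proof -
  interpret L: prob_space "law (Suc k)" by (rule prob_space_law) simp
  have [measurable]: "(\<lambda>y. F (Suc k) u y) \<in> borel_measurable borel" for u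
    by (intro F_measurable) (auto simp: measurable_const space_PiM)
  \<comment> \<open>One history of the process and one innovation \<open>y0\<close> serve as
    reference; they exist because an almost sure property holds somewhere.\<close>
  obtain \<omega> y0 where "AE y in law (Suc k). dist (F (Suc k) (H k \<omega>) y0) (F (Suc k) (H k \<omega>) y) \<le> Mb (Suc k)"
    using AE_imp_ex[OF AE_step_oscillation[OF assms(1)]] L.AE_imp_ex by blast
  then have "integrable (law (Suc k)) (\<lambda>y. dist (F (Suc k) (H k \<omega>) y) (F (Suc k) (H k \<omega>) y0))"
    by (intro L.integrable_const_bound[where B = "Mb (Suc k)"]) (auto simp: dist_commute)
  with contraction_law(1)[OF assms(2) shares_past_H[of k \<omega>]]
  have "integrable (law (Suc k)) (\<lambda>y. dist (F (Suc k) s y) (F (Suc k) (H k \<omega>) y)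
      + dist (F (Suc k) (H k \<omega>) y) (F (Suc k) (H k \<omega>) y0))"
    by (rule Bochner_Integration.integrable_add)
  then have "integrable (law (Suc k)) (\<lambda>y. dist (F (Suc k) s y) (F (Suc k) (H k \<omega>) y0))"
    by (rule Bochner_Integration.integrable_bound) (auto simp: dist_triangle intro: order_trans)
  then show ?thesis by blast
qed

text \<open>The Lipschitz bound is a hypothesis because \<open>cond_mean_lipschitz\<close> supplies
  it from its own induction hypothesis, while needing this integrability for its next step.\<close>

lemma integrable_cond_mean_step:
  assumes "Suc k \<le> n" "shares_past k s"
    and lipschitz: "\<And>x x'. \<bar>cond_mean (n - Suc k) (case_nat x s) - cond_mean (n - Suc k) (case_nat x' s)\<bar> \<le> C * dist x x'"
  shows "integrable (law (Suc k)) (\<lambda>y. cond_mean (n - Suc k) (case_nat (F (Suc k) s y) s))"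
proof -
  interpret L: prob_space "law (Suc k)" by (rule prob_space_law) simp
  have [measurable]: "(\<lambda>y. F (Suc k) s y) \<in> borel_measurable borel"
    by (intro F_measurable) (auto simp: measurable_const space_PiM)
  have [measurable]: "(\<lambda>_. s) \<in> measurable borel histories"
    by (auto simp: measurable_const space_PiM)
  obtain x0 where "integrable (law (Suc k)) (\<lambda>y. dist (F (Suc k) s y) x0)"
    using integrable_dist_point[OF assms(1,2)] by blast
  then have "integrable (law (Suc k)) (\<lambda>y. C * dist (F (Suc k) s y) x0 + \<bar>cond_mean (n - Suc k) (case_nat x0 s)\<bar>)"
    by simp
  then show ?thesis
  proof (rule Bochner_Integration.integrable_bound)
    have "(\<lambda>y. case_nat (F (Suc k) s y) s) \<in> measurable (law (Suc k)) histories"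
      by measurable
    then show "(\<lambda>y. cond_mean (n - Suc k) (case_nat (F (Suc k) s y) s)) \<in> borel_measurable (law (Suc k))"
      by (rule measurable_compose) simp
    show "AE y in law (Suc k). norm (cond_mean (n - Suc k) (case_nat (F (Suc k) s y) s))
        \<le> norm (C * dist (F (Suc k) s y) x0 + \<bar>cond_mean (n - Suc k) (case_nat x0 s)\<bar>)"
      using lipschitz[of _ x0] by (intro always_eventually allI) (smt (verit) real_norm_def)
  qed
qed

text \<open>Induction on the number of remaining steps. Both histories are extended with the same
  innovation \<open>y\<close>, \<open>contraction_law\<close> averages the distance of the two new
  states, and \<open>lip_Suc\<close> collects the coefficients.\<close>

lemma cond_mean_lipschitz:
  assumes "m \<le> n" "shares_past (n - m) s" "shares_past (n - m) s'"
  shows "\<bar>cond_mean m s - cond_mean m s'\<bar> \<le> (\<Sum>j<n - m. lip a m j * dist (s j) (s' j))"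
  using assms
proof (induction m arbitrary: s s')
  case 0
  have "\<bar>cond_mean 0 s - cond_mean 0 s'\<bar> \<le> (\<Sum>i=1..n. dist ((\<lambda>i\<in>{1..n}. s (n - i)) i) ((\<lambda>i\<in>{1..n}. s' (n - i)) i))"
    unfolding cond_mean.simps by (rule f_lip) auto
  also have "\<dots> = (\<Sum>i=1..n. dist (s (n - i)) (s' (n - i)))" by simp
  also have "\<dots> = (\<Sum>j<n. dist (s j) (s' j))"
    by (rule sum.reindex_bij_witness[where i = "\<lambda>j. n - j" and j = "\<lambda>i. n - i"]) auto
  finally show ?case by (simp add: lip_0)
next
  case (Suc m)
  define k where "k = n - Suc m"
  have k: "n - m = Suc k" "Suc k \<le> n" "n - Suc k = m" using Suc.prems by (auto simp: k_def)
  interpret L: prob_space "law (Suc k)" by (rule prob_space_law) simp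
  have IH: "\<bar>cond_mean m (case_nat x u) - cond_mean m (case_nat x' u')\<bar>
      \<le> lip a m 0 * dist x x' + (\<Sum>j<k. lip a m (Suc j) * dist (u j) (u' j))"
    if "shares_past k u" "shares_past k u'" for x x' u u'
    using Suc.IH[of "case_nat x u" "case_nat x' u'"] shares_past_Suc[OF that(1)] shares_past_Suc[OF that(2)] Suc.prems(1)
    by (simp add: k sum.lessThan_Suc_shift del: sum.lessThan_Suc)
  have shares_past: "shares_past k s" "shares_past k s'" using Suc.prems by (simp_all add: k_def)
  define G where "G = (\<lambda>u y. cond_mean m (case_nat (F (Suc k) u y) u))"
  have G: "integrable (law (Suc k)) (G u)" if "shares_past k u" for u
    unfolding G_def using integrable_cond_mean_step[of k u "lip a m 0"] IH[OF that that] that k by simp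
  define d where "d = (\<lambda>y. dist (F (Suc k) s y) (F (Suc k) s' y))"
  note d = contraction_law[OF shares_past, folded d_def]
  define c where "c = (\<Sum>j<k. lip a m (Suc j) * dist (s j) (s' j))"
  have "\<bar>cond_mean (Suc m) s - cond_mean (Suc m) s'\<bar> = \<bar>\<integral>y. G s y - G s' y \<partial>law (Suc k)\<bar>"
    using G shares_past by (simp add: k G_def)
  also have "\<dots> \<le> (\<integral>y. \<bar>G s y - G s' y\<bar> \<partial>law (Suc k))"
    by (rule integral_abs_bound)
  also have "\<dots> \<le> (\<integral>y. lip a m 0 * d y + c \<partial>law (Suc k))"
  proof (rule integral_mono)
    show "integrable (law (Suc k)) (\<lambda>y. \<bar>G s y - G s' y\<bar>)" using G shares_past by simp
    show "integrable (law (Suc k)) (\<lambda>y. lip a m 0 * d y + c)" using d by simp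
    show "\<bar>G s y - G s' y\<bar> \<le> lip a m 0 * d y + c" for y
      unfolding G_def d_def c_def using shares_past by (rule IH)
  qed
  also have "\<dots> = lip a m 0 * (\<integral>y. d y \<partial>law (Suc k)) + c"
    using d by (simp add: L.prob_space)
  also have "\<dots> \<le> lip a m 0 * (\<Sum>j<k. a (Suc j) * dist (s j) (s' j)) + c"
    using d(2) lip_nonneg[of a m 0] a_nonneg by (intro add_right_mono mult_left_mono) auto
  also have "\<dots> = (\<Sum>j<k. lip a (Suc m) j * dist (s j) (s' j))"
    by (simp add: c_def lip_Suc lip_diag sum_distrib_left sum.distrib[symmetric] algebra_simps)
  finally show ?case by (simp add: k_def)
qed

section \<open>Oscillation of the martingale and its moment generating function\<close>

definition osc :: "nat \<Rightarrow> real" where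
  "osc k = a_diag a (n - k) * Mb k"

lemma osc_pos: "k \<in> {1..n} \<Longrightarrow> osc k > 0"
  unfolding osc_def using a_diag_ge_1[of a "n - k", OF a_nonneg] Mb_pos[of k]
  by (intro mult_pos_pos) auto

text \<open>The value of the martingale at time \<open>Suc k\<close> as a function of the innovation
  \<open>y\<close>; the martingale difference is this minus its integral over
  \<open>y\<close>.\<close>

definition incr :: "nat \<Rightarrow> (nat \<Rightarrow> 'x) \<Rightarrow> 'y \<Rightarrow> real" where
  "incr k s y = cond_mean (n - Suc k) (case_nat (F (Suc k) s y) s)"

lemma cond_mean_eq_integral_incr: "k < n \<Longrightarrow> cond_mean (n - k) s = (\<integral>y. incr k s y \<partial>law (Suc k))"
proof -
  assume "k < n"
  then have "n - k = Suc (n - Suc k)" "n - (n - Suc k) = Suc k" by auto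
  then show ?thesis by (simp add: incr_def)
qed

lemma cond_mean_H_Suc: "cond_mean (n - Suc k) (H (Suc k) \<omega>) = incr k (H k \<omega>) (\<epsilon> (Suc k) \<omega>)"
  by (simp add: incr_def H_Suc)

lemma incr_measurable_pair [measurable]: "(\<lambda>z. incr k (fst z) (snd z)) \<in> borel_measurable (histories \<Otimes>\<^sub>M borel)"
  unfolding incr_def
  by (rule measurable_compose[OF _ cond_mean_measurable]) (auto intro!: measurable_case_nat' F_measurable)

lemma incr_measurable [measurable]: "incr k s \<in> borel_measurable (law k')"
proof -
  have "(\<lambda>y. (s, y)) \<in> measurable borel (histories \<Otimes>\<^sub>M borel)"
    by (intro measurable_Pair) (auto simp: measurable_const space_PiM)
  from measurable_compose[OF this incr_measurable_pair] show ?thesis by simp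
qed

text \<open>Two continuations of one history differ in the head only, so a single term of the
  Lipschitz bound survives, with constant \<open>lip a m 0 = a_diag a m\<close> for m = n - (k +
  1).\<close>

lemma AE_incr_oscillation:
  assumes "k < n"
  shows "AE \<omega> in M. AE y in law (Suc k). AE y' in law (Suc k). \<bar>incr k (H k \<omega>) y - incr k (H k \<omega>) y'\<bar> \<le> osc (Suc k)"
proof -
  have "Suc k \<le> n" using assms by simp
  then have n_minus: "n - (n - Suc k) = Suc k" by simp
  have "\<bar>incr k (H k \<omega>) y - incr k (H k \<omega>) y'\<bar> \<le> osc (Suc k)"
    if "dist (F (Suc k) (H k \<omega>) y) (F (Suc k) (H k \<omega>) y') \<le> Mb (Suc k)" for \<omega> y y'
  proof -
    have "\<bar>incr k (H k \<omega>) y - incr k (H k \<omega>) y'\<bar>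
        \<le> (\<Sum>j<Suc k. lip a (n - Suc k) j * dist (case_nat (F (Suc k) (H k \<omega>) y) (H k \<omega>) j)
            (case_nat (F (Suc k) (H k \<omega>) y') (H k \<omega>) j))"
      unfolding incr_def
      using cond_mean_lipschitz[of "n - Suc k", unfolded n_minus, OF _ shares_past_Suc shares_past_Suc, OF _ shares_past_H shares_past_H] by simp
    also have "\<dots> = a_diag a (n - Suc k) * dist (F (Suc k) (H k \<omega>) y) (F (Suc k) (H k \<omega>) y')"
      by (simp add: sum.lessThan_Suc_shift lip_diag del: sum.lessThan_Suc)
    also have "\<dots> \<le> osc (Suc k)"
      unfolding osc_def using that a_diag_ge_1[of a "n - Suc k", OF a_nonneg]
      by (intro mult_left_mono) auto
    finally show ?thesis .
  qed
  then show ?thesis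
    using AE_step_oscillation[OF \<open>Suc k \<le> n\<close>] by (auto elim!: eventually_mono)
qed

text \<open>Given the history, exp (t (m - c)) with m the current conditional mean leaves the inner
  integral, and \<open>mgf_le_of_oscillation\<close> bounds what remains. The centering
  \<open>c\<close> stays arbitrary until \<open>mgf_f\<close>.\<close>

lemma mgf_cond_mean:
  assumes "t \<ge> 0" "k \<le> n"
  shows "(\<integral>\<^sup>+\<omega>. ennreal (exp (t * (cond_mean (n - k) (H k \<omega>) - c))) \<partial>M)
    \<le> ennreal (exp (t * (cond_mean n (\<lambda>j. past (- int j)) - c))) * ennreal (exp (\<Sum>i=1..k. ell (osc i * t)))"
  using assms(2)
proof (induction k)
  case 0
  show ?case by (simp add: H_def emeasure_space_1)
next
  case (Suc k)
  then have k: "k < n" by simp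
  interpret L: prob_space "law (Suc k)" by (rule prob_space_law) simp
  have "(\<integral>\<^sup>+\<omega>. ennreal (exp (t * (cond_mean (n - Suc k) (H (Suc k) \<omega>) - c))) \<partial>M)
      = (\<integral>\<^sup>+\<omega>. \<integral>\<^sup>+y. ennreal (exp (t * (incr k (H k \<omega>) y - c))) \<partial>law (Suc k) \<partial>M)"
    unfolding cond_mean_H_Suc
    using nn_integral_step[of "\<lambda>z. ennreal (exp (t * (incr k (fst z) (snd z) - c)))" k] by simp
  also have "\<dots> \<le> (\<integral>\<^sup>+\<omega>. ennreal (exp (t * (cond_mean (n - k) (H k \<omega>) - c))) * ennreal (exp (ell (osc (Suc k) * t))) \<partial>M)"
  proof (rule nn_integral_mono_AE)
    show "AE \<omega> in M. (\<integral>\<^sup>+y. ennreal (exp (t * (incr k (H k \<omega>) y - c))) \<partial>law (Suc k))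
        \<le> ennreal (exp (t * (cond_mean (n - k) (H k \<omega>) - c))) * ennreal (exp (ell (osc (Suc k) * t)))"
      using AE_incr_oscillation[OF k]
    proof eventually_elim
      case (elim \<omega>)
      define m where "m = cond_mean (n - k) (H k \<omega>)"
      have m: "m = L.expectation (incr k (H k \<omega>))"
        unfolding m_def by (rule cond_mean_eq_integral_incr[OF k])
      have "(\<integral>\<^sup>+y. ennreal (exp (t * (incr k (H k \<omega>) y - c))) \<partial>law (Suc k))
          = (\<integral>\<^sup>+y. ennreal (exp (t * (m - c))) * ennreal (exp (t * (incr k (H k \<omega>) y - m))) \<partial>law (Suc k))"
        by (intro nn_integral_cong) (simp add: algebra_simps flip: ennreal_mult exp_add)
      also have "\<dots> = ennreal (exp (t * (m - c))) * (\<integral>\<^sup>+y. ennreal (exp (t * (incr k (H k \<omega>) y - m))) \<partial>law (Suc k))"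
        by (rule nn_integral_cmult) simp
      also have "\<dots> \<le> ennreal (exp (t * (m - c))) * ennreal (exp (ell (osc (Suc k) * t)))"
        unfolding m using elim osc_pos[of "Suc k"] k assms(1)
        by (intro mult_left_mono L.mgf_le_of_oscillation) auto
      finally show ?case by (simp add: m_def)
    qed
  qed
  also have "\<dots> = (\<integral>\<^sup>+\<omega>. ennreal (exp (t * (cond_mean (n - k) (H k \<omega>) - c))) \<partial>M) * ennreal (exp (ell (osc (Suc k) * t)))"
    by (rule nn_integral_multc) simp
  also have "\<dots> \<le> (ennreal (exp (t * (cond_mean n (\<lambda>j. past (- int j)) - c))) * ennreal (exp (\<Sum>i=1..k. ell (osc i * t))))
      * ennreal (exp (ell (osc (Suc k) * t)))"
    using Suc by (intro mult_right_mono) auto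
  also have "\<dots> = ennreal (exp (t * (cond_mean n (\<lambda>j. past (- int j)) - c))) * ennreal (exp (\<Sum>i=1..Suc k. ell (osc i * t)))"
    by (simp add: exp_add ennreal_mult mult.assoc)
  finally show ?case .
qed

text \<open>The martingale differences \<open>g\<close> have conditional mean zero and conditional
  absolute mean at most \<open>osc (Suc k)\<close>, so integrability and mean pass from
  \<open>k\<close> to \<open>Suc k\<close>. At k = n this identifies the mean subtracted in
  S_n.\<close>

lemma expectation_cond_mean:
  assumes "k \<le> n"
  shows "integrable M (\<lambda>\<omega>. cond_mean (n - k) (H k \<omega>))"
    and "expectation (\<lambda>\<omega>. cond_mean (n - k) (H k \<omega>)) = cond_mean n (\<lambda>j. past (- int j))"
proof -
  have "integrable M (\<lambda>\<omega>. cond_mean (n - k) (H k \<omega>)) \<and>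
      expectation (\<lambda>\<omega>. cond_mean (n - k) (H k \<omega>)) = cond_mean n (\<lambda>j. past (- int j))"
    using assms
  proof (induction k)
    case 0
    show ?case by (simp add: H_def prob_space)
  next
    case (Suc k)
    then have k: "k < n" by simp
    interpret L: prob_space "law (Suc k)" by (rule prob_space_law) simp
    have [measurable]: "cond_mean (n - k) \<in> borel_measurable histories" by (rule cond_mean_measurable) simp
    define g where "g = (\<lambda>z. incr k (fst z) (snd z) - cond_mean (n - k) (fst z))"
    have g_meas [measurable]: "g \<in> borel_measurable (histories \<Otimes>\<^sub>M borel)"
      unfolding g_def by measurable
    have AE: "AE \<omega> in M. (\<integral>\<^sup>+y. ennreal (norm (g (H k \<omega>, y))) \<partial>law (Suc k)) \<le> ennreal (osc (Suc k)) \<and>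
        (\<integral>y. g (H k \<omega>, y) \<partial>law (Suc k)) = 0"
      using AE_incr_oscillation[OF k]
    proof eventually_elim
      case (elim \<omega>)
      note * = L.integrable_of_oscillation[OF incr_measurable elim]
      have "(\<integral>\<^sup>+y. ennreal (norm (g (H k \<omega>, y))) \<partial>law (Suc k)) \<le> (\<integral>\<^sup>+y. ennreal (osc (Suc k)) \<partial>law (Suc k))"
        using *(2) by (intro nn_integral_mono_AE) (auto elim!: eventually_mono simp: g_def cond_mean_eq_integral_incr[OF k] intro!: ennreal_leI)
      then show ?case
        using *(1) by (simp add: L.emeasure_space_1 L.prob_space g_def cond_mean_eq_integral_incr[OF k])
    qed
    have int: "integrable M (\<lambda>\<omega>. g (H k \<omega>, \<epsilon> (Suc k) \<omega>))"
    proof (rule integrableI_bounded)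
      have "(\<integral>\<^sup>+\<omega>. ennreal (norm (g (H k \<omega>, \<epsilon> (Suc k) \<omega>))) \<partial>M)
          = (\<integral>\<^sup>+\<omega>. \<integral>\<^sup>+y. ennreal (norm (g (H k \<omega>, y))) \<partial>law (Suc k) \<partial>M)"
        by (rule nn_integral_step) measurable
      also have "\<dots> \<le> (\<integral>\<^sup>+\<omega>. ennreal (osc (Suc k)) \<partial>M)"
        using AE by (intro nn_integral_mono_AE) (auto elim!: eventually_mono)
      also have "\<dots> < \<infinity>" by (simp add: emeasure_space_1)
      finally show "(\<integral>\<^sup>+\<omega>. ennreal (norm (g (H k \<omega>, \<epsilon> (Suc k) \<omega>))) \<partial>M) < \<infinity>" .
    qed measurable
    have "expectation (\<lambda>\<omega>. g (H k \<omega>, \<epsilon> (Suc k) \<omega>)) = (\<integral>\<omega>. \<integral>y. g (H k \<omega>, y) \<partial>law (Suc k) \<partial>M)"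
      by (rule integral_step[OF g_meas int])
    also have "\<dots> = 0"
      using AE by (intro integral_eq_zero_AE) (auto elim!: eventually_mono)
    finally have zero: "expectation (\<lambda>\<omega>. g (H k \<omega>, \<epsilon> (Suc k) \<omega>)) = 0" .
    have eq: "cond_mean (n - Suc k) (H (Suc k) \<omega>) = cond_mean (n - k) (H k \<omega>) + g (H k \<omega>, \<epsilon> (Suc k) \<omega>)" for \<omega>
      by (simp add: cond_mean_H_Suc g_def)
    show ?case
      unfolding eq using Suc int zero by simp
  qed
  then show "integrable M (\<lambda>\<omega>. cond_mean (n - k) (H k \<omega>))"
    and "expectation (\<lambda>\<omega>. cond_mean (n - k) (H k \<omega>)) = cond_mean n (\<lambda>j. past (- int j))" by auto
qed

lemma f_eq_cond_mean: "\<omega> \<in> space M \<Longrightarrow> f (\<lambda>i\<in>{1..n}. X (int i) \<omega>) = cond_mean 0 (H n \<omega>)"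
  by (auto simp: H_eq_X intro!: arg_cong[where f = f] restrict_ext)

lemma f_measurable [measurable]: "(\<lambda>\<omega>. f (\<lambda>i\<in>{1..n}. X (int i) \<omega>)) \<in> borel_measurable M"
proof -
  have "(\<lambda>\<omega>. cond_mean 0 (H n \<omega>)) \<in> borel_measurable M"
    using cond_mean_0_measurable by measurable
  then show ?thesis by (subst measurable_cong[OF f_eq_cond_mean])
qed

lemma mgf_f:
  assumes "t \<ge> 0"
  shows "(\<integral>\<^sup>+\<omega>. ennreal (exp (t * (f (\<lambda>i\<in>{1..n}. X (int i) \<omega>) - expectation (\<lambda>\<omega>. f (\<lambda>i\<in>{1..n}. X (int i) \<omega>))))) \<partial>M)
    \<le> ennreal (exp (\<Sum>i=1..n. ell (osc i * t)))"
proof -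
  have "expectation (\<lambda>\<omega>. f (\<lambda>i\<in>{1..n}. X (int i) \<omega>)) = expectation (\<lambda>\<omega>. cond_mean 0 (H n \<omega>))"
    by (intro Bochner_Integration.integral_cong f_eq_cond_mean) auto
  also have "\<dots> = cond_mean n (\<lambda>j. past (- int j))"
    using expectation_cond_mean(2)[of n] by simp
  finally have e: "expectation (\<lambda>\<omega>. f (\<lambda>i\<in>{1..n}. X (int i) \<omega>)) = cond_mean n (\<lambda>j. past (- int j))" .
  have "(\<integral>\<^sup>+\<omega>. ennreal (exp (t * (f (\<lambda>i\<in>{1..n}. X (int i) \<omega>) - cond_mean n (\<lambda>j. past (- int j))))) \<partial>M)
      = (\<integral>\<^sup>+\<omega>. ennreal (exp (t * (cond_mean (n - n) (H n \<omega>) - cond_mean n (\<lambda>j. past (- int j))))) \<partial>M)"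
    by (intro nn_integral_cong) (simp only: f_eq_cond_mean diff_self_eq_0)
  also have "\<dots> \<le> ennreal (exp (\<Sum>i=1..n. ell (osc i * t)))"
    using mgf_cond_mean[OF assms order_refl, of "cond_mean n (\<lambda>j. past (- int j))"] by simp
  finally show ?thesis unfolding e .
qed

end

section \<open>Deviation inequalities\<close>

text \<open>Chernoff's bound after taking logarithms. A positive tail makes the right side a genuine
  logarithm; a vanishing tail is trivial in both deviation inequalities below.\<close>

lemma (in prob_space) ell_star_le_of_mgf:
  fixes Y :: "'a \<Rightarrow> real"
  assumes [measurable]: "Y \<in> borel_measurable M"
    and "V > 0" "D > 0"
    and mgf: "\<And>t. t \<ge> 0 \<Longrightarrow> (\<integral>\<^sup>+\<omega>. ennreal (exp (t * Y \<omega>)) \<partial>M) \<le> ennreal (exp (D\<^sup>2 / V * ell (V * t / D)))"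
    and pos: "\<P>(\<omega> in M. Y \<omega> > x) > 0"
  shows "ell_star (x / D) \<le> ereal (- ln \<P>(\<omega> in M. Y \<omega> > x) / (D\<^sup>2 / V))"
  unfolding ell_star_def
proof (rule SUP_least)
  fix u :: real assume "u \<in> {0<..}"
  then have u: "u > 0" by simp
  define c where "c = D\<^sup>2 / V"
  \<comment> \<open>Chosen so that V t / D is the variable \<open>u\<close> of the supremum defining
    \<open>ell_star\<close>.\<close>
  define t where "t = u * D / V"
  have c: "c > 0" and t: "t > 0" using u assms(2,3) by (auto simp: c_def t_def)
  have eqs: "V * t / D = u" "t * x = c * (u * (x / D))"
    using assms(2,3) by (auto simp: c_def t_def power2_eq_square)
  have "emeasure M {\<omega>\<in>space M. Y \<omega> > x} \<le> emeasure M {\<omega>\<in>space M. Y \<omega> \<ge> x}"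
    by (intro emeasure_mono) auto
  also have "\<dots> \<le> ennreal (exp (- t * x)) * (\<integral>\<^sup>+\<omega>. ennreal (exp (t * Y \<omega>)) * indicator (space M) \<omega> \<partial>M)"
    using Chernoff_ineq_nn_integral_ge[OF t, of "space M" M Y x] by simp
  also have "(\<integral>\<^sup>+\<omega>. ennreal (exp (t * Y \<omega>)) * indicator (space M) \<omega> \<partial>M) = (\<integral>\<^sup>+\<omega>. ennreal (exp (t * Y \<omega>)) \<partial>M)"
    by (intro nn_integral_cong) simp
  also have "ennreal (exp (- t * x)) * \<dots> \<le> ennreal (exp (- t * x)) * ennreal (exp (c * ell u))"
    using mgf[of t] t unfolding eqs c_def by (intro mult_left_mono) auto
  also have "\<dots> = ennreal (exp (- (c * (u * (x / D) - ell u))))"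
    using eqs(2) by (simp add: algebra_simps flip: ennreal_mult exp_add)
  finally have "\<P>(\<omega> in M. Y \<omega> > x) \<le> exp (- (c * (u * (x / D) - ell u)))"
    by (simp add: emeasure_eq_measure)
  then have "ln \<P>(\<omega> in M. Y \<omega> > x) \<le> - (c * (u * (x / D) - ell u))"
    using pos by (metis ln_exp ln_le_cancel_iff exp_gt_zero)
  then have "(u * (x / D) - ell u) * c \<le> - ln \<P>(\<omega> in M. Y \<omega> > x)"
    by (simp add: mult.commute)
  then have "u * (x / D) - ell u \<le> - ln \<P>(\<omega> in M. Y \<omega> > x) / c"
    unfolding pos_le_divide_eq[OF c] .
  then show "ereal (x / D * u - ell u) \<le> ereal (- ln \<P>(\<omega> in M. Y \<omega> > x) / (D\<^sup>2 / V))"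
    by (simp add: c_def mult.commute)
qed

lemma exp_ereal_nonneg: "exp_ereal z \<ge> 0"
  by (simp add: exp_ereal_def)

lemma (in prob_space) tail_le_exp_ell_star:
  fixes Y :: "'a \<Rightarrow> real"
  assumes "Y \<in> borel_measurable M" "V > 0" "D > 0"
    and "\<And>t. t \<ge> 0 \<Longrightarrow> (\<integral>\<^sup>+\<omega>. ennreal (exp (t * Y \<omega>)) \<partial>M) \<le> ennreal (exp (D\<^sup>2 / V * ell (V * t / D)))"
  shows "ereal (\<P>(\<omega> in M. Y \<omega> > x)) \<le> exp_ereal (- (ereal (D\<^sup>2 / V) * ell_star (x / D)))"
proof (cases "\<P>(\<omega> in M. Y \<omega> > x) > 0")
  case True
  define c where "c = D\<^sup>2 / V"
  define p where "p = \<P>(\<omega> in M. Y \<omega> > x)"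
  have c: "c > 0" using assms(2,3) by (simp add: c_def)
  have p: "p > 0" using True by (simp add: p_def)
  have le: "ell_star (x / D) \<le> ereal (- ln p / c)"
    unfolding c_def p_def by (rule ell_star_le_of_mgf[OF assms True])
  \<comment> \<open>The point t = 1 of the supremum excludes minus infinity, so
    \<open>ell_star (x / D)\<close> is a real number here.\<close>
  have "ereal (x / D * 1 - ell 1) \<le> ell_star (x / D)"
    unfolding ell_star_def by (rule SUP_upper) simp
  then obtain e where e: "ell_star (x / D) = ereal e"
    using le by (cases "ell_star (x / D)") auto
  have "e * c \<le> - ln p" using le unfolding e ereal_less_eq(3) pos_le_divide_eq[OF c] .
  then have "exp (ln p) \<le> exp (- (c * e))" by (subst exp_le_cancel_iff) (simp add: mult.commute)
  then show ?thesis
    using p unfolding p_def[symmetric] c_def[symmetric] e by (simp add: exp_ereal_def)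
next
  case False
  then have "\<P>(\<omega> in M. Y \<omega> > x) = 0" by (simp add: not_less measure_le_0_iff)
  then show ?thesis by (simp add: exp_ereal_nonneg flip: zero_ereal_def)
qed

lemma (in prob_space) tail_le_powr:
  fixes Y :: "'a \<Rightarrow> real"
  assumes "Y \<in> borel_measurable M" "V > 0" "D > 0"
    and "\<And>t. t \<ge> 0 \<Longrightarrow> (\<integral>\<^sup>+\<omega>. ennreal (exp (t * Y \<omega>)) \<partial>M) \<le> ennreal (exp (D\<^sup>2 / V * ell (V * t / D)))"
    and x: "0 \<le> x" "x \<le> D"
  shows "\<P>(\<omega> in M. Y \<omega> > x) \<le> ((D - x) / D) powr ((2 * D * x - x\<^sup>2) / V)"
proof (cases "\<P>(\<omega> in M. Y \<omega> > x) > 0")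
  case True
  define c where "c = D\<^sup>2 / V"
  define p where "p = \<P>(\<omega> in M. Y \<omega> > x)"
  have c: "c > 0" using assms(2,3) by (simp add: c_def)
  have p: "p > 0" using True by (simp add: p_def)
  have le: "ell_star (x / D) \<le> ereal (- ln p / c)"
    unfolding c_def p_def by (rule ell_star_le_of_mgf[OF assms(1-4) True])
  show ?thesis
  proof (cases "x = 0")
    case True
    then show ?thesis using \<open>D > 0\<close> by simp
  next
    case False
    \<comment> \<open>At x = D the rate is infinite, which contradicts \<open>le\<close>; a positive
      tail is therefore impossible at this endpoint.\<close>
    have "x \<noteq> D" using le ell_star_1 \<open>D > 0\<close> by auto
    define y where "y = x / D"
    have y: "0 < y" "y < 1" using False \<open>x \<noteq> D\<close> x \<open>D > 0\<close> by (auto simp: y_def)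
    have "ereal ((y\<^sup>2 - 2 * y) * ln (1 - y)) \<le> ereal (- ln p / c)"
      using ell_star_ge[OF y] le unfolding y_def by (rule order_trans)
    then have "((y\<^sup>2 - 2 * y) * ln (1 - y)) * c \<le> - ln p"
      unfolding ereal_less_eq(3) pos_le_divide_eq[OF c] .
    then have "ln p \<le> c * (2 * y - y\<^sup>2) * ln (1 - y)"
      by (simp add: algebra_simps)
    then have "exp (ln p) \<le> exp (c * (2 * y - y\<^sup>2) * ln (1 - y))" by simp
    then have "p \<le> (1 - y) powr (c * (2 * y - y\<^sup>2))"
      using p y by (simp add: powr_def)
    also have "1 - y = (D - x) / D" using \<open>D > 0\<close> by (simp add: y_def diff_divide_distrib)
    also have "c * (2 * y - y\<^sup>2) = (2 * D * x - x\<^sup>2) / V"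
      using assms(2,3) by (simp add: c_def y_def field_simps power2_eq_square)
    finally show ?thesis by (simp add: p_def)
  qed
next
  case False
  then have "\<P>(\<omega> in M. Y \<omega> > x) = 0" by (simp add: not_less measure_le_0_iff)
  then show ?thesis by simp
qed

theorem proposition4p9:
  fixes M :: "'w measure"
    and \<epsilon> \<epsilon>' :: "nat \<Rightarrow> 'w \<Rightarrow> 'y::polish_space"
    and X :: "int \<Rightarrow> 'w \<Rightarrow> 'x::polish_space"
    and past :: "int \<Rightarrow> 'x"
    and F :: "nat \<Rightarrow> (nat \<Rightarrow> 'x) \<Rightarrow> 'y \<Rightarrow> 'x"
    and a :: "nat \<Rightarrow> real"
    and n :: nat
    and f :: "(nat \<Rightarrow> 'x) \<Rightarrow> real"
    and Mb :: "nat \<Rightarrow> real"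
    and S :: "'w \<Rightarrow> real"
    and M2 D :: real
  assumes prob: "prob_space M"
    and indep: "prob_space.indep_vars M (\<lambda>_. borel) \<epsilon> {1..}"
    and F_meas: "\<And>m. m \<ge> 1 \<Longrightarrow> (\<lambda>(s, y). F m s y) \<in> measurable ((\<Pi>\<^sub>M j\<in>UNIV. borel) \<Otimes>\<^sub>M borel) borel"
    and X_past: "\<And>i \<omega>. i \<le> 0 \<Longrightarrow> \<omega> \<in> space M \<Longrightarrow> X i \<omega> = past i"
    and X_rec: "\<And>m \<omega>. m \<ge> 1 \<Longrightarrow> \<omega> \<in> space M \<Longrightarrow>
          X (int m) \<omega> = F m (preceding (\<lambda>i. X i \<omega>) m) (\<epsilon> m \<omega>)"
    and a_nonneg: "\<And>i. i \<ge> 1 \<Longrightarrow> a i \<ge> 0"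
    and a_summable: "summable (\<lambda>j. a (Suc j))"
    and a_sum: "(\<Sum>j. a (Suc j)) < 1"
    and contraction: "\<And>m s s'. m \<ge> 1 \<Longrightarrow>
          (\<integral>\<^sup>+\<omega>. ennreal (dist (F m s (\<epsilon> m \<omega>)) (F m s' (\<epsilon> m \<omega>))) \<partial>M)
            \<le> (\<Sum>j. ennreal (a (Suc j) * dist (s j) (s' j)))"
    and n: "n \<ge> 1"
    and f_lip: "\<And>x x'. x \<in> {1..n} \<rightarrow>\<^sub>E UNIV \<Longrightarrow> x' \<in> {1..n} \<rightarrow>\<^sub>E UNIV \<Longrightarrow>
          \<bar>f x - f x'\<bar> \<le> (\<Sum>i=1..n. dist (x i) (x' i))"
    and S: "\<And>\<omega>. S \<omega> = f (\<lambda>i\<in>{1..n}. X (int i) \<omega>) - (\<integral>\<omega>'. f (\<lambda>i\<in>{1..n}. X (int i) \<omega>') \<partial>M)"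
    and copy: "prob_space.indep_copy M {1..} borel \<epsilon> \<epsilon>'"
    and Mb_pos: "\<And>k. k \<in> {1..n} \<Longrightarrow> Mb k > 0"
    and Mb_bound: "\<And>k. k \<in> {1..n} \<Longrightarrow>
          esssup M (\<lambda>\<omega>. ennreal (dist (F k (preceding (\<lambda>i. X i \<omega>) k) (\<epsilon> k \<omega>))
                                       (F k (preceding (\<lambda>i. X i \<omega>) k) (\<epsilon>' k \<omega>)))) \<le> ennreal (Mb k)"
    and M2: "M2 = (\<Sum>k=1..n. (a_diag a (n - k) * Mb k)\<^sup>2)"
    and D: "D = (\<Sum>k=1..n. a_diag a (n - k) * Mb k)"
  shows "\<forall>\<sigma>\<in>{1, -1 :: real}.
      (\<forall>t\<ge>0. (\<integral>\<^sup>+\<omega>. ennreal (exp (\<sigma> * t * S \<omega>)) \<partial>M) \<le> ennreal (exp (D\<^sup>2 / M2 * ell (M2 * t / D)))) \<and>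
      (\<forall>x\<in>{0..D}. ereal (\<P>(\<omega> in M. \<sigma> * S \<omega> > x)) \<le> exp_ereal (- (ereal (D\<^sup>2 / M2) * ell_star (x / D)))) \<and>
      (\<forall>x\<in>{0..D}. \<P>(\<omega> in M. \<sigma> * S \<omega> > x) \<le> ((D - x) / D) powr ((2 * D * x - x\<^sup>2) / M2))"
proof -
  interpret P: random_iteration M \<epsilon> \<epsilon>' X past F a n f Mb
    by (intro random_iteration.intro random_iteration_axioms.intro prob indep F_meas X_past X_rec
        a_nonneg contraction f_lip copy Mb_pos Mb_bound) assumption+
  \<comment> \<open>The lower tail of \<open>f\<close> is the upper tail of -f, which satisfies the
    same Lipschitz bound.\<close>
  interpret N: random_iteration M \<epsilon> \<epsilon>' X past F a n "\<lambda>x. - f x" Mb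
    by (intro random_iteration.intro random_iteration_axioms.intro prob indep F_meas X_past X_rec
        a_nonneg contraction copy Mb_pos Mb_bound)
      (use f_lip in \<open>auto simp: abs_minus_commute\<close>)
  have osc: "P.osc k = a_diag a (n - k) * Mb k" "N.osc k = a_diag a (n - k) * Mb k" for k
    by (simp_all add: P.osc_def N.osc_def)
  have D_pos: "D > 0" and M2_pos: "M2 > 0"
    unfolding D M2 osc(1)[symmetric] using n P.osc_pos
    by (auto intro!: sum_pos zero_less_power)
  have sum_le: "(\<Sum>k=1..n. ell (P.osc k * t)) \<le> D\<^sup>2 / M2 * ell (M2 * t / D)" if "t \<ge> 0" for t
    unfolding D M2 osc(1)[symmetric] using n P.osc_pos that by (intro sum_ell_le) auto
  have S_meas: "S \<in> borel_measurable M"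
    unfolding S[abs_def] by measurable
  have mgf: "(\<integral>\<^sup>+\<omega>. ennreal (exp (t * (\<sigma> * S \<omega>))) \<partial>M) \<le> ennreal (exp (D\<^sup>2 / M2 * ell (M2 * t / D)))"
    if "\<sigma> \<in> {1, -1}" "t \<ge> 0" for \<sigma> t
  proof -
    have "(\<integral>\<^sup>+\<omega>. ennreal (exp (t * (\<sigma> * S \<omega>))) \<partial>M) \<le> ennreal (exp (\<Sum>k=1..n. ell (P.osc k * t)))"
      using that P.mgf_f[of t] N.mgf_f[of t] by (auto simp: S osc algebra_simps)
    also have "\<dots> \<le> ennreal (exp (D\<^sup>2 / M2 * ell (M2 * t / D)))"
      using sum_le[OF that(2)] by (intro ennreal_leI) simp
    finally show ?thesis .
  qed
  show ?thesis
  proof (intro ballI conjI allI impI)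
    fix \<sigma> t :: real assume *: "\<sigma> \<in> {1, -1}" "0 \<le> t"
    show "(\<integral>\<^sup>+\<omega>. ennreal (exp (\<sigma> * t * S \<omega>)) \<partial>M) \<le> ennreal (exp (D\<^sup>2 / M2 * ell (M2 * t / D)))"
      using mgf[OF *] by (simp add: mult_ac)
  next
    fix \<sigma> x :: real assume *: "\<sigma> \<in> {1, -1}" "x \<in> {0..D}"
    have Y: "(\<lambda>\<omega>. \<sigma> * S \<omega>) \<in> borel_measurable M" using S_meas by measurable
    show "ereal (\<P>(\<omega> in M. \<sigma> * S \<omega> > x)) \<le> exp_ereal (- (ereal (D\<^sup>2 / M2) * ell_star (x / D)))"
      by (rule P.tail_le_exp_ell_star[OF Y M2_pos D_pos mgf[OF *(1)]])
    show "\<P>(\<omega> in M. \<sigma> * S \<omega> > x) \<le> ((D - x) / D) powr ((2 * D * x - x\<^sup>2) / M2)"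
      using * by (intro P.tail_le_powr[OF Y M2_pos D_pos mgf[OF *(1)]]) auto
  qed
qed

end
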